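(* Let $\mathcal{H}_A,\mathcal{H}_B$ be finite-dimensional Hilbert spaces and let $\mathcal{S}$ be the convex set of density operators on $\mathcal{H}_A\otimes\mathcal{H}_B$. Then squashed entanglement $E_{sq}:\mathcal{S}\to\mathbb{R}$ satisfies: (a) $E_{sq}$ is continuous on the interior of $\mathcal{S}$, i.e. on the set of faithful (full-rank) states; more generally, for every face $F$ of $\mathcal{S}$, the restriction of $E_{sq}$ to the relative interior of $F$ is continuous; (b) $E_{sq}$ is continuous on the set of all rank-$2$ density operators on $\mathcal{H}_A\otimes\mathcal{H}_B$.
   Context: For a state $\rho$ on a tensor product of systems, $\rho^X$ denotes its reduced state on the subsystem $X$, and $S(X)=S(\rho^X)=-\operatorname{Tr}\rho^X\log\rho^X$ is the von Neumann entropy ($\log$ to base 2). For a tripartite state $\rho^{ABE}$ the quantum conditional mutual information is $I(A;B|E)=S(AE)+S(BE)-S(ABE)-S(E)$. The squashed entanglement of a state $\rho^{AB}$ on $\mathcal{H}_A\otimes\mathcal{H}_B$ is $$E_{sq}(\rho^{AB})=\inf\left\{\tfrac12 I(A;B|E)\;:\;\rho^{ABE}\text{ a state on }\mathcal{H}_A\otimes\mathcal{H}_B\otimes\mathcal{H}_E\text{ with }\operatorname{Tr}_E\rho^{ABE}=\rho^{AB}\right\},$$ where the infimum is over all extensions $\rho^{ABE}$, with $\mathcal{H}_E$ of arbitrary (a priori unbounded) finite dimension. Continuity is with respect to the trace norm; interior means interior relative to the affine space of trace-one Hermitian operators, and the relative interior of a face is its interior relative to its affine hull. *)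

theory Defs
  imports "HOL-Analysis.Analysis"
begin

(* The dimension of the extending system E is quantified inside the infimum that defines squashed
   entanglement, so it cannot be a type.  An operator on the Hilbert space with orthonormal basis I
   (a finite set) is therefore given by its matrix entries M i j for i, j in I; entries outside I
   are irrelevant.  For operators on the fixed space of A and B the library matrix type is used. *)

type_synonym 'i opm = "'i \<Rightarrow> 'i \<Rightarrow> complex"

definition entries :: "complex^'n^'n \<Rightarrow> 'n opm"
  where "entries M = (\<lambda>i j. M $ i $ j)"

definition op_mult :: "'i set \<Rightarrow> 'i opm \<Rightarrow> 'i opm \<Rightarrow> 'i opm"
  where "op_mult I M N = (\<lambda>i j. \<Sum>k\<in>I. M i k * N k j)"

definition op_adj :: "'i opm \<Rightarrow> 'i opm"
  where "op_adj M = (\<lambda>i j. cnj (M j i))"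

definition op_trace :: "'i set \<Rightarrow> 'i opm \<Rightarrow> complex"
  where "op_trace I M = (\<Sum>i\<in>I. M i i)"

definition hermitian_on :: "'i set \<Rightarrow> 'i opm \<Rightarrow> bool"
  where "hermitian_on I M \<longleftrightarrow> (\<forall>i\<in>I. \<forall>j\<in>I. M i j = cnj (M j i))"

definition psd_on :: "'i set \<Rightarrow> 'i opm \<Rightarrow> bool"
  where "psd_on I M \<longleftrightarrow> hermitian_on I M \<and>
    (\<forall>v. 0 \<le> Re (\<Sum>i\<in>I. \<Sum>j\<in>I. cnj (v i) * M i j * v j))"

definition density_on :: "'i set \<Rightarrow> 'i opm \<Rightarrow> bool"
  where "density_on I M \<longleftrightarrow> finite I \<and> psd_on I M \<and> op_trace I M = 1"

definition unitary_on :: "'i set \<Rightarrow> 'i opm \<Rightarrow> bool"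
  where "unitary_on I U \<longleftrightarrow>
    (\<forall>i\<in>I. \<forall>j\<in>I. op_mult I U (op_adj U) i j = (if i = j then 1 else 0)) \<and>
    (\<forall>i\<in>I. \<forall>j\<in>I. op_mult I (op_adj U) U i j = (if i = j then 1 else 0))"

definition conj_diag :: "'i set \<Rightarrow> 'i opm \<Rightarrow> ('i \<Rightarrow> real) \<Rightarrow> 'i opm"
  where "conj_diag I U d = (\<lambda>i j. \<Sum>k\<in>I. U i k * of_real (d k) * cnj (U j k))"

definition diagonalizes :: "'i set \<Rightarrow> 'i opm \<Rightarrow> 'i opm \<Rightarrow> ('i \<Rightarrow> real) \<Rightarrow> bool"
  where "diagonalizes I M U d \<longleftrightarrow>
    unitary_on I U \<and> (\<forall>i\<in>I. \<forall>j\<in>I. M i j = conj_diag I U d i j)"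

(* Functional calculus of a Hermitian operator M = U diag(d) U*, namely f(M) = U diag(f o d) U*.
   The entries on I do not depend on the chosen diagonalization. *)
definition op_fun :: "'i set \<Rightarrow> (real \<Rightarrow> real) \<Rightarrow> 'i opm \<Rightarrow> 'i opm"
  where "op_fun I f M =
    (let (U, d) = (SOME (U, d). diagonalizes I M U d) in conj_diag I U (\<lambda>k. f (d k)))"

(* The convention 0 log 0 = 0 holds automatically, as log 2 is a total function. *)
definition vn_entropy :: "'i set \<Rightarrow> 'i opm \<Rightarrow> real"
  where "vn_entropy I \<rho> = - Re (op_trace I (op_mult I \<rho> (op_fun I (log 2) \<rho>)))"

definition trace_norm :: "'i set \<Rightarrow> 'i opm \<Rightarrow> real"
  where "trace_norm I M = Re (op_trace I (op_fun I sqrt (op_mult I (op_adj M) M)))"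

definition red_AB :: "nat \<Rightarrow> (('a \<times> 'b) \<times> nat) opm \<Rightarrow> ('a \<times> 'b) opm"
  where "red_AB n \<sigma> = (\<lambda>x y. \<Sum>e<n. \<sigma> (x, e) (y, e))"

definition red_AE :: "(('a \<times> 'b::finite) \<times> nat) opm \<Rightarrow> ('a \<times> nat) opm"
  where "red_AE \<sigma> = (\<lambda>(a, e) (a', e'). \<Sum>b\<in>UNIV. \<sigma> ((a, b), e) ((a', b), e'))"

definition red_BE :: "(('a::finite \<times> 'b) \<times> nat) opm \<Rightarrow> ('b \<times> nat) opm"
  where "red_BE \<sigma> = (\<lambda>(b, e) (b', e'). \<Sum>a\<in>UNIV. \<sigma> ((a, b), e) ((a, b'), e'))"

definition red_E :: "(('a::finite \<times> 'b::finite) \<times> nat) opm \<Rightarrow> nat opm"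
  where "red_E \<sigma> = (\<lambda>e e'. \<Sum>x\<in>UNIV. \<sigma> (x, e) (x, e'))"

definition cond_mutual_info :: "nat \<Rightarrow> (('a::finite \<times> 'b::finite) \<times> nat) opm \<Rightarrow> real"
  where "cond_mutual_info n \<sigma> =
    vn_entropy (UNIV \<times> {..<n}) (red_AE \<sigma>) + vn_entropy (UNIV \<times> {..<n}) (red_BE \<sigma>)
    - vn_entropy (UNIV \<times> {..<n}) \<sigma> - vn_entropy {..<n} (red_E \<sigma>)"

definition density_operators :: "(complex^'n^'n) set"
  where "density_operators = {\<rho>. density_on UNIV (entries \<rho>)}"

definition trace_one_hermitian :: "(complex^'n^'n) set"
  where "trace_one_hermitian = {M. hermitian_on UNIV (entries M) \<and> trace M = 1}"

definition extension :: "complex^('a::finite \<times> 'b::finite)^('a \<times> 'b) \<Rightarrow> nat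
    \<Rightarrow> (('a \<times> 'b) \<times> nat) opm \<Rightarrow> bool"
  where "extension \<rho> n \<sigma> \<longleftrightarrow> density_on (UNIV \<times> {..<n}) \<sigma> \<and> red_AB n \<sigma> = entries \<rho>"

definition squashed_entanglement :: "complex^('a::finite \<times> 'b::finite)^('a \<times> 'b) \<Rightarrow> real"
  where "squashed_entanglement \<rho> = Inf {cond_mutual_info n \<sigma> / 2 | n \<sigma>. extension \<rho> n \<sigma>}"

definition trace_norm_continuous_on ::
    "(complex^'n::finite^'n) set \<Rightarrow> (complex^'n^'n \<Rightarrow> real) \<Rightarrow> bool"
  where "trace_norm_continuous_on X f \<longleftrightarrow>
    (\<forall>\<rho>\<in>X. \<forall>\<epsilon>>0. \<exists>\<delta>>0. \<forall>\<sigma>\<in>X.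
      trace_norm UNIV (entries (\<sigma> - \<rho>)) < \<delta> \<longrightarrow> \<bar>f \<sigma> - f \<rho>\<bar> < \<epsilon>)"

end

theory Submission
  imports Defs
begin

text \<open>
  Squashed entanglement is uniformly continuous on the set of all states, so that every continuity
  claim follows at once. Positive operators \<open>X\<close>, \<open>Y\<close> satisfy \<open>S(X + Y) \<le> S(X) + S(Y)\<close> by monotonicity of the
  logarithm, and the reverse inequality up to a small error when \<open>Tr Y\<close> is small by Klein's inequality;
  comparing \<open>X\<close> with the tensor product of the identity and its partial trace bounds the
  conditional mutual information by a multiple of \<open>Tr X\<close>. Neither bound depends on
  the dimension of \<open>E\<close>, hence adding an operator of small trace changes \<open>I(A;B|E)\<close> by little.
  Strong subadditivity is avoided: only boundedness from below of \<open>I(A;B|E)\<close> matters.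
  If \<open>\<sigma>\<close> is close to \<open>\<rho>\<close>, an extension of \<open>\<rho>\<close> is turned into one of \<open>\<sigma>\<close> by mixing it with a full-rank
  state and conjugating with an operator on \<open>AB\<close> that is close to the identity.
\<close>

text \<open>The first obstacle is uniformity in the dimension of \<open>E\<close>. Adding a small
  positive \<open>Y\<close> may change a single entropy by about Tr Y times log dim E. The entropy
  of \<open>Y\<close> is therefore kept as a separate term, and the four such terms recombine into
  I(A;B|E) of \<open>Y\<close>, which is controlled by Tr Y and the dimension of \<open>B\<close>.
  As this covers positive increments only, two operators are always compared through a common
  positive part or a common sum. The second obstacle is rank. Conjugation cannot raise it, hence the
  mixing. Even afterwards K = \<sigma>^(1/2) \<omega>^(-1/2) may be singular and far from the
  identity in operator norm. Its closeness to the identity is meant relative to the state: for L = K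
  - 1, L \<omega>^(1/2) = \<sigma>^(1/2) - \<omega>^(1/2), so the trace of \<omega> conjugated by L
  is the squared Hilbert-Schmidt distance of two square roots, which the Powers-Stoermer argument
  bounds. That trace lives on \<open>AB\<close>, so the choice of extension does not enter
  it.\<close>

section \<open>Vectors, inner products and quadratic forms over an index set\<close>

definition inner_on :: "'i set \<Rightarrow> ('i \<Rightarrow> complex) \<Rightarrow> ('i \<Rightarrow> complex) \<Rightarrow> complex"
  where "inner_on I u v = (\<Sum>i\<in>I. cnj (u i) * v i)"

definition mat_vec :: "'i set \<Rightarrow> 'i opm \<Rightarrow> ('i \<Rightarrow> complex) \<Rightarrow> 'i \<Rightarrow> complex"
  where "mat_vec I M v = (\<lambda>i. \<Sum>j\<in>I. M i j * v j)"

definition quad_form :: "'i set \<Rightarrow> 'i opm \<Rightarrow> ('i \<Rightarrow> complex) \<Rightarrow> real"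
  where "quad_form I M v = Re (inner_on I v (mat_vec I M v))"

definition norm2_on :: "'i set \<Rightarrow> ('i \<Rightarrow> complex) \<Rightarrow> real"
  where "norm2_on I v = (\<Sum>i\<in>I. (cmod (v i))\<^sup>2)"

lemma quad_form_sum:
  "quad_form I M v = Re (\<Sum>i\<in>I. \<Sum>j\<in>I. cnj (v i) * M i j * v j)"
  by (simp add: quad_form_def inner_on_def mat_vec_def sum_distrib_left mult.assoc)

lemma psd_on_iff: "psd_on I M \<longleftrightarrow> hermitian_on I M \<and> (\<forall>v. 0 \<le> quad_form I M v)"
  by (simp add: psd_on_def quad_form_sum)

lemma inner_on_cong:
  "(\<And>i. i \<in> I \<Longrightarrow> u i = u' i) \<Longrightarrow> (\<And>i. i \<in> I \<Longrightarrow> v i = v' i) \<Longrightarrow> inner_on I u v = inner_on I u' v'"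
  by (simp add: inner_on_def)

lemma inner_on_cnj: "cnj (inner_on I u v) = inner_on I v u"
  by (simp add: inner_on_def mult.commute)

lemma inner_on_add_right: "inner_on I u (\<lambda>i. v i + w i) = inner_on I u v + inner_on I u w"
  by (simp add: inner_on_def algebra_simps sum.distrib)

lemma inner_on_diff_right: "inner_on I u (\<lambda>i. v i - w i) = inner_on I u v - inner_on I u w"
  by (simp add: inner_on_def algebra_simps sum_subtractf)

lemma inner_on_scale_right: "inner_on I u (\<lambda>i. c * v i) = c * inner_on I u v"
  by (simp add: inner_on_def sum_distrib_left mult_ac)

lemma inner_on_add_left: "inner_on I (\<lambda>i. v i + w i) u = inner_on I v u + inner_on I w u"
  by (simp add: inner_on_def algebra_simps sum.distrib)

lemma inner_on_diff_left: "inner_on I (\<lambda>i. v i - w i) u = inner_on I v u - inner_on I w u"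
  by (simp add: inner_on_def algebra_simps sum_subtractf)

lemma inner_on_scale_left: "inner_on I (\<lambda>i. c * v i) u = cnj c * inner_on I v u"
  by (simp add: inner_on_def sum_distrib_left mult_ac)

lemma inner_on_sum_right:
  "inner_on I u (\<lambda>i. \<Sum>k\<in>K. f k i) = (\<Sum>k\<in>K. inner_on I u (f k))"
  by (simp add: inner_on_def sum_distrib_left) (rule sum.swap)

lemma inner_on_sum_left:
  "inner_on I (\<lambda>i. \<Sum>k\<in>K. f k i) u = (\<Sum>k\<in>K. inner_on I (f k) u)"
  by (simp add: inner_on_def sum_distrib_right) (rule sum.swap)

lemma inner_on_self: "inner_on I v v = of_real (norm2_on I v)"
  unfolding inner_on_def norm2_on_def of_real_sum
  by (rule sum.cong) (auto simp: complex_norm_square mult.commute simp del: of_real_power)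

lemma norm2_on_nonneg: "0 \<le> norm2_on I v"
  by (simp add: norm2_on_def sum_nonneg)

lemma norm2_on_eq_0: "finite I \<Longrightarrow> norm2_on I v = 0 \<longleftrightarrow> (\<forall>i\<in>I. v i = 0)"
  by (simp add: norm2_on_def sum_nonneg_eq_0_iff)

lemma mat_vec_add: "mat_vec I M (\<lambda>i. v i + w i) = (\<lambda>i. mat_vec I M v i + mat_vec I M w i)"
  by (simp add: mat_vec_def algebra_simps sum.distrib)

lemma mat_vec_scale: "mat_vec I M (\<lambda>i. c * v i) = (\<lambda>i. c * mat_vec I M v i)"
  by (simp add: mat_vec_def sum_distrib_left mult_ac)

lemma hermitian_on_inner:
  assumes "hermitian_on I M"
  shows "inner_on I u (mat_vec I M v) = inner_on I (mat_vec I M u) v"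
proof -
  have "inner_on I u (mat_vec I M v) = (\<Sum>i\<in>I. \<Sum>j\<in>I. cnj (u i) * M i j * v j)"
    by (simp add: inner_on_def mat_vec_def sum_distrib_left mult.assoc)
  also have "\<dots> = (\<Sum>j\<in>I. \<Sum>i\<in>I. cnj (u i) * M i j * v j)"
    by (rule sum.swap)
  also have "\<dots> = (\<Sum>j\<in>I. \<Sum>i\<in>I. cnj (M j i) * cnj (u i) * v j)"
  proof (intro sum.cong refl)
    fix i j assume "i \<in> I" "j \<in> I"
    then have "M i j = cnj (M j i)" using assms unfolding hermitian_on_def by blast
    then show "cnj (u i) * M i j * v j = cnj (M j i) * cnj (u i) * v j"
      by (simp only: mult.commute)
  qed
  finally show ?thesis
    by (simp add: inner_on_def mat_vec_def sum_distrib_right)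
qed

section \<open>Spectral theorem\<close>

text \<open>Vectors are functions on the whole index type, which may be infinite. Forcing the value
  0 outside \<open>I\<close> places the set in a product of unit discs and singletons, compact by
  Tychonoff, and leaves a closed condition.\<close>

lemma compact_sphere_on:
  fixes I :: "'i set" and u :: "'i \<Rightarrow> 'i \<Rightarrow> complex"
  assumes "finite I"
  shows "compact {v. (\<forall>i. i \<notin> I \<longrightarrow> v i = 0) \<and> norm2_on I v = 1 \<and> (\<forall>j\<in>J. inner_on I (u j) v = 0)}"
    (is "compact ?W")
proof -
  let ?C = "PiE UNIV (\<lambda>i. if i \<in> I then cball 0 1 else {0}) :: ('i \<Rightarrow> complex) set"
  have "compact ?C"
  proof -
    have "compactin (product_topology (\<lambda>i. euclidean) UNIV) ?C"
      unfolding compactin_PiE by auto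
    then show ?thesis
      by (simp add: euclidean_product_topology)
  qed
  moreover have "closed {v::'i \<Rightarrow> complex. norm2_on I v = 1 \<and> (\<forall>j\<in>J. inner_on I (u j) v = 0)}"
    unfolding norm2_on_def inner_on_def Ball_def
    by (intro closed_Collect_conj closed_Collect_all closed_Collect_imp open_Collect_const
        closed_Collect_eq continuous_intros continuous_on_product_coordinates)
  ultimately have "compact (?C \<inter> {v. norm2_on I v = 1 \<and> (\<forall>j\<in>J. inner_on I (u j) v = 0)})"
    by (rule compact_Int_closed)
  moreover have "?C \<inter> {v. norm2_on I v = 1 \<and> (\<forall>j\<in>J. inner_on I (u j) v = 0)} = ?W"
  proof -
    have "cmod (v i) \<le> 1" if "norm2_on I v = 1" "i \<in> I" for v i
    proof -
      have "(cmod (v i))\<^sup>2 \<le> norm2_on I v"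
        unfolding norm2_on_def by (rule member_le_sum) (use that assms in auto)
      then show ?thesis using that by (simp add: power_le_one_iff abs_square_le_1)
    qed
    then show ?thesis by (auto simp: PiE_def split: if_splits)
  qed
  ultimately show ?thesis by simp
qed

text \<open>Families are labelled by indices of the space itself, so that a family on all of
  \<open>I\<close> is at once a square matrix over \<open>I\<close>.\<close>

definition orthonormal_on :: "'i set \<Rightarrow> 'i set \<Rightarrow> ('i \<Rightarrow> 'i \<Rightarrow> complex) \<Rightarrow> bool"
  where "orthonormal_on I J u \<longleftrightarrow>
    (\<forall>j\<in>J. \<forall>k\<in>J. inner_on I (u j) (u k) = (if j = k then 1 else 0))"

lemma bessel_defect:
  assumes "finite J" "orthonormal_on I J u"
  shows "norm2_on I (\<lambda>i. v i - (\<Sum>j\<in>J. inner_on I (u j) v * u j i))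
    = norm2_on I v - (\<Sum>j\<in>J. (cmod (inner_on I (u j) v))\<^sup>2)"
proof -
  let ?p = "\<lambda>i. \<Sum>j\<in>J. inner_on I (u j) v * u j i"
  have a: "inner_on I w ?p = (\<Sum>j\<in>J. inner_on I (u j) v * inner_on I w (u j))" for w
    by (simp add: inner_on_sum_right inner_on_scale_right)
  have b: "inner_on I (u k) ?p = inner_on I (u k) v" if "k \<in> J" for k
    using assms that by (simp add: a orthonormal_on_def if_distrib[of "\<lambda>x. _ * x"] cong: if_cong)
  have c: "inner_on I ?p w = (\<Sum>j\<in>J. cnj (inner_on I (u j) v) * inner_on I (u j) w)" for w
    by (simp add: inner_on_sum_left inner_on_scale_left)
  have d: "inner_on I ?p ?p = inner_on I ?p v"
    unfolding c using b by simp
  have e: "inner_on I v ?p = inner_on I ?p v"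
    unfolding a c by (simp add: inner_on_cnj mult.commute)
  have f: "inner_on I ?p v = of_real (\<Sum>j\<in>J. (cmod (inner_on I (u j) v))\<^sup>2)"
    unfolding c of_real_sum
    by (intro sum.cong refl) (simp add: complex_norm_square mult.commute del: of_real_power)
  have "inner_on I (\<lambda>i. v i - ?p i) (\<lambda>i. v i - ?p i) = inner_on I v v - inner_on I ?p v"
    by (simp add: inner_on_diff_left inner_on_diff_right d e)
  then have "complex_of_real (norm2_on I (\<lambda>i. v i - ?p i))
      = of_real (norm2_on I v - (\<Sum>j\<in>J. (cmod (inner_on I (u j) v))\<^sup>2))"
    by (simp only: inner_on_self f of_real_diff)
  then show ?thesis by (simp only: of_real_eq_iff)
qed

lemma inner_on_residual:
  assumes "finite J" "orthonormal_on I J u" "k \<in> J"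
  shows "inner_on I (u k) (\<lambda>i. v i - (\<Sum>j\<in>J. inner_on I (u j) v * u j i)) = 0"
  using assms
  by (simp add: inner_on_diff_right inner_on_sum_right inner_on_scale_right orthonormal_on_def
      if_distrib[of "\<lambda>x. _ * x"] cong: if_cong)

abbreviation unit_vec :: "'i \<Rightarrow> 'i \<Rightarrow> complex"
  where "unit_vec i \<equiv> (\<lambda>l. if l = i then 1 else 0)"

lemma inner_on_unit_vec: "finite I \<Longrightarrow> i \<in> I \<Longrightarrow> inner_on I u (unit_vec i) = cnj (u i)"
  by (simp add: inner_on_def if_distrib[of "\<lambda>x. _ * x"] cong: if_cong)

lemma norm2_on_unit_vec: "finite I \<Longrightarrow> i \<in> I \<Longrightarrow> norm2_on I (unit_vec i) = 1"
  by (simp add: norm2_on_def if_distrib[of cmod] if_distrib[of "\<lambda>x. x\<^sup>2"] cong: if_cong)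

text \<open>The trace of the projection onto the complement of the span of \<open>u j\<close>, \<open>j \<in> J\<close>,
  computed in the standard basis.\<close>

lemma sum_residual:
  assumes "finite I" "J \<subseteq> I" "orthonormal_on I J u"
  shows "(\<Sum>i\<in>I. norm2_on I (\<lambda>l. unit_vec i l - (\<Sum>j\<in>J. inner_on I (u j) (unit_vec i) * u j l)))
    = real (card I) - real (card J)"
proof -
  have fJ: "finite J" using assms finite_subset by blast
  have "(\<Sum>i\<in>I. norm2_on I (\<lambda>l. unit_vec i l - (\<Sum>j\<in>J. inner_on I (u j) (unit_vec i) * u j l)))
      = (\<Sum>i\<in>I. 1 - (\<Sum>j\<in>J. (cmod (u j i))\<^sup>2))"
    using assms(1)
    by (intro sum.cong refl, subst bessel_defect[OF fJ assms(3)])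
      (simp add: inner_on_unit_vec norm2_on_unit_vec)
  also have "\<dots> = real (card I) - (\<Sum>j\<in>J. norm2_on I (u j))"
    unfolding sum_subtractf norm2_on_def by (simp add: sum.swap[of _ J I])
  also have "(\<Sum>j\<in>J. norm2_on I (u j)) = (\<Sum>j\<in>J. 1)"
  proof (intro sum.cong refl)
    fix j assume "j \<in> J"
    then have "complex_of_real (norm2_on I (u j)) = 1"
      using assms(3) unfolding inner_on_self[symmetric] orthonormal_on_def by simp
    then show "norm2_on I (u j) = 1" by simp
  qed
  finally show ?thesis by simp
qed

text \<open>First-order optimality: for small \<open>e > 0\<close> a positive linear term would beat
  the quadratic one.\<close>

lemma quad_perturb_zero:
  fixes a c :: real
  assumes "\<And>e. 2 * e * a \<le> e\<^sup>2 * c" "0 \<le> a"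
  shows "a = 0"
proof (rule ccontr)
  assume "a \<noteq> 0"
  with assms have a: "a > 0" by simp
  define e where "e = a / (\<bar>c\<bar> + 1)"
  have e: "e > 0" using a by (simp add: e_def)
  have "2 * a \<le> e * c" using assms(1)[of e] e by (simp add: power2_eq_square)
  also have "\<dots> \<le> e * (\<bar>c\<bar> + 1)" using e by (intro mult_left_mono) auto
  also have "\<dots> = a" by (simp add: e_def)
  finally show False using a by simp
qed

text \<open>Rayleigh's principle: a maximizer \<open>v\<close> of the quadratic form on the unit
  sphere orthogonal to the eigenvectors already found is an eigenvector, with the maximum
  \<open>c\<close> as eigenvalue. The residual \<open>r\<close> of \<open>v\<close> stays in the
  orthogonal complement because \<open>M\<close> is Hermitian, so \<open>v\<close> may be varied in
  the direction \<open>r\<close>.\<close>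

lemma eigenvector_step:
  fixes I :: "'i set"
  assumes I: "finite I" and M: "hermitian_on I M" and J: "J \<subset> I" and on: "orthonormal_on I J u"
    and eig: "\<forall>j\<in>J. \<forall>i\<in>I. mat_vec I M (u j) i = of_real (d j) * u j i"
  shows "\<exists>v c. norm2_on I v = 1 \<and> (\<forall>j\<in>J. inner_on I (u j) v = 0) \<and>
    (\<forall>i\<in>I. mat_vec I M v i = of_real c * v i)"
proof -
  define W where "W = {v. (\<forall>i. i \<notin> I \<longrightarrow> v i = 0) \<and> norm2_on I v = 1 \<and> (\<forall>j\<in>J. inner_on I (u j) v = 0)}"
  have cW: "compact W" unfolding W_def by (rule compact_sphere_on[OF I])
  have fJ: "finite J" using I J finite_subset by blast
  have scaled: "\<exists>w\<in>W. \<forall>i\<in>I. v i = of_real (sqrt (norm2_on I v)) * w i"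
    if v: "norm2_on I v \<noteq> 0" "\<forall>j\<in>J. inner_on I (u j) v = 0" for v
  proof -
    define s where "s = sqrt (norm2_on I v)"
    have s: "s > 0" "s\<^sup>2 = norm2_on I v" using v norm2_on_nonneg[of I v] by (auto simp: s_def)
    define w where "w = (\<lambda>i. if i \<in> I then of_real (inverse s) * v i else 0)"
    have "inner_on I (u j) w = 0" if "j \<in> J" for j
    proof -
      have "inner_on I (u j) w = inner_on I (u j) (\<lambda>i. of_real (inverse s) * v i)"
        by (rule inner_on_cong) (auto simp: w_def)
      then show ?thesis using v that by (simp only: inner_on_scale_right) simp
    qed
    moreover have "norm2_on I w = (inverse s)\<^sup>2 * norm2_on I v"
      unfolding norm2_on_def sum_distrib_left
      by (intro sum.cong refl) (simp add: w_def norm_mult norm_inverse power_mult_distrib power_inverse)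
    then have "norm2_on I w = 1" unfolding s(2)[symmetric] using s(1) by (simp add: power_inverse)
    ultimately have "w \<in> W" by (auto simp: W_def w_def)
    moreover have "\<forall>i\<in>I. v i = of_real s * w i" using s by (simp add: w_def)
    ultimately show ?thesis unfolding s_def by blast
  qed
  have Wne: "W \<noteq> {}"
  proof -
    \<comment> \<open>The complement of the span has projection of trace
      \<open>card I - card J > 0\<close>, so some standard basis vector has a nonzero residual,
      which is then normalized.\<close>
    have "card J < card I" using I J by (rule psubset_card_mono)
    then have "(\<Sum>i\<in>I. norm2_on I (\<lambda>l. unit_vec i l - (\<Sum>j\<in>J. inner_on I (u j) (unit_vec i) * u j l))) \<noteq> 0"
      using sum_residual[OF I _ on] J by auto
    then obtain i where "i \<in> I"
      "norm2_on I (\<lambda>l. unit_vec i l - (\<Sum>j\<in>J. inner_on I (u j) (unit_vec i) * u j l)) \<noteq> 0"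
      by (meson sum.neutral)
    from scaled[OF this(2)] inner_on_residual[OF fJ on] show ?thesis by fast
  qed
  have "continuous_on UNIV (quad_form I M)"
    unfolding quad_form_sum by (intro continuous_intros continuous_on_product_coordinates)
  then have cont: "continuous_on W (quad_form I M)"
    by (rule continuous_on_subset) simp
  from continuous_attains_sup[OF cW Wne cont]
  obtain v where v: "v \<in> W" and max: "\<forall>w\<in>W. quad_form I M w \<le> quad_form I M v"
    by blast
  define c where "c = quad_form I M v"
  have le: "quad_form I M w \<le> c * norm2_on I w" if w: "\<forall>j\<in>J. inner_on I (u j) w = 0" for w
  proof (cases "norm2_on I w = 0")
    case True
    then have "\<forall>i\<in>I. w i = 0" using I by (simp add: norm2_on_eq_0)
    then show ?thesis using True by (simp add: quad_form_def inner_on_def)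
  next
    case False
    then obtain x where x: "x \<in> W" and wx: "\<forall>i\<in>I. w i = of_real (sqrt (norm2_on I w)) * x i"
      using scaled w by blast
    have "quad_form I M w = quad_form I M (\<lambda>i. of_real (sqrt (norm2_on I w)) * x i)"
      unfolding quad_form_sum using wx by simp
    also have "\<dots> = norm2_on I w * quad_form I M x"
      by (simp add: quad_form_def mat_vec_scale inner_on_scale_left inner_on_scale_right
          norm2_on_nonneg flip: mult.assoc of_real_mult)
    also have "\<dots> \<le> norm2_on I w * c"
      unfolding c_def using max x norm2_on_nonneg by (intro mult_left_mono) auto
    finally show ?thesis by (simp add: mult.commute)
  qed
  have vJ: "\<forall>j\<in>J. inner_on I (u j) v = 0" and v1: "norm2_on I v = 1" using v by (auto simp: W_def)
  define r where "r = (\<lambda>i. mat_vec I M v i - of_real c * v i)"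
  have rJ: "inner_on I (u j) r = 0" if j: "j \<in> J" for j
  proof -
    have "inner_on I (u j) (mat_vec I M v) = inner_on I (\<lambda>i. of_real (d j) * u j i) v"
      unfolding hermitian_on_inner[OF M] using eig j by (intro inner_on_cong) auto
    then show ?thesis
      using vJ j by (simp add: r_def inner_on_diff_right inner_on_scale_right inner_on_scale_left)
  qed
  \<comment> \<open>Compare the quadratic form with \<open>c\<close> times the squared norm at
    \<open>v + e r\<close>. The constant terms agree, and the terms in \<open>g\<close> cancel
    because \<open>b = norm2_on I r + c * g\<close>.\<close>
  have "2 * e * norm2_on I r \<le> e\<^sup>2 * (c * norm2_on I r - quad_form I M r)" for e :: real
  proof -
    let ?w = "\<lambda>i. v i + of_real e * r i"
    have orth: "\<forall>j\<in>J. inner_on I (u j) ?w = 0"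
      using vJ rJ by (simp add: inner_on_add_right inner_on_scale_right)
    define b where "b = Re (inner_on I r (mat_vec I M v))"
    define g where "g = Re (inner_on I r v)"
    have b': "Re (inner_on I v (mat_vec I M r)) = b"
      unfolding hermitian_on_inner[OF M, of v r] b_def by (subst inner_on_cnj[symmetric]) simp
    have g': "Re (inner_on I v r) = g"
      unfolding g_def by (subst inner_on_cnj[symmetric]) simp
    have q: "quad_form I M ?w = c + 2 * e * b + e\<^sup>2 * quad_form I M r"
      using b' by (simp add: quad_form_def mat_vec_add mat_vec_scale inner_on_add_left inner_on_add_right
          inner_on_scale_left inner_on_scale_right c_def b_def power2_eq_square algebra_simps)
    have "complex_of_real (norm2_on I ?w) = inner_on I ?w ?w" by (simp only: inner_on_self)
    then have "norm2_on I ?w = Re (inner_on I ?w ?w)" by (metis Re_complex_of_real)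
    also have "\<dots> = 1 + 2 * e * g + e\<^sup>2 * norm2_on I r"
      using g' v1 by (simp add: inner_on_add_left inner_on_add_right
          inner_on_scale_left inner_on_scale_right inner_on_self g_def power2_eq_square algebra_simps)
    finally have n: "norm2_on I ?w = 1 + 2 * e * g + e\<^sup>2 * norm2_on I r" .
    have "inner_on I r r = inner_on I r (mat_vec I M v) - of_real c * inner_on I r v"
      by (subst (2) r_def) (simp add: inner_on_diff_right inner_on_scale_right)
    then have b: "b = norm2_on I r + c * g" by (simp add: inner_on_self complex_eq_iff b_def g_def)
    show ?thesis using le[OF orth] unfolding q n b by (simp add: algebra_simps)
  qed
  then have "norm2_on I r = 0" using norm2_on_nonneg by (rule quad_perturb_zero)
  then have "\<forall>i\<in>I. mat_vec I M v i = of_real c * v i" using I by (simp add: norm2_on_eq_0 r_def)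
  then show ?thesis using vJ v1 by blast
qed

text \<open>One half of unitarity is orthonormality. For the other, the residuals of the standard
  basis have total squared norm \<open>card I - card I = 0\<close>, so each of them
  vanishes.\<close>

lemma orthonormal_basis_unitary:
  assumes I: "finite I" and on: "orthonormal_on I I u"
  shows "unitary_on I (\<lambda>i k. u k i)"
proof -
  have res: "\<forall>i\<in>I. norm2_on I (\<lambda>l. unit_vec i l - (\<Sum>j\<in>I. inner_on I (u j) (unit_vec i) * u j l)) = 0"
    by (subst sum_nonneg_eq_0_iff[OF I, symmetric]) (auto simp: norm2_on_nonneg sum_residual[OF I order_refl on])
  have "(\<Sum>k\<in>I. u k i * cnj (u k j)) = (if i = j then 1 else 0)" if "i \<in> I" "j \<in> I" for i j
  proof -
    have "unit_vec j i - (\<Sum>k\<in>I. inner_on I (u k) (unit_vec j) * u k i) = 0"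
      using res[rule_format, OF that(2)] that(1) unfolding norm2_on_eq_0[OF I] by blast
    then show ?thesis
      unfolding inner_on_unit_vec[OF I that(2)] by (simp only: mult.commute[of "cnj _"] right_minus_eq)
  qed
  moreover have "(\<Sum>k\<in>I. cnj (u i k) * u j k) = (if i = j then 1 else 0)" if "i \<in> I" "j \<in> I" for i j
    using on that by (auto simp: orthonormal_on_def inner_on_def)
  ultimately show ?thesis
    by (simp add: unitary_on_def op_mult_def op_adj_def)
qed

theorem spectral_theorem_on:
  assumes I: "finite I" and M: "hermitian_on I M"
  shows "\<exists>U d. diagonalizes I M U d"
proof -
  have "J \<subseteq> I \<Longrightarrow> \<exists>u d. orthonormal_on I J u \<and> (\<forall>j\<in>J. \<forall>i\<in>I. mat_vec I M (u j) i = of_real (d j) * u j i)"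
    if "finite J" for J using that
  proof (induction J)
    case empty
    show ?case by (auto simp: orthonormal_on_def)
  next
    case (insert x J)
    then obtain u d where ud: "orthonormal_on I J u"
      "\<forall>j\<in>J. \<forall>i\<in>I. mat_vec I M (u j) i = of_real (d j :: real) * u j i" by auto
    have "J \<subset> I" using insert by auto
    from eigenvector_step[OF I M this ud] obtain v c where v: "norm2_on I v = 1"
      "\<forall>j\<in>J. inner_on I (u j) v = 0" "\<forall>i\<in>I. mat_vec I M v i = of_real c * v i" by blast
    have v2: "inner_on I v v = 1" using v by (simp add: inner_on_self)
    have v3: "\<forall>j\<in>J. inner_on I v (u j) = 0" using v inner_on_cnj by (metis complex_cnj_zero)
    show ?case
    proof (intro exI conjI)
      show "orthonormal_on I (insert x J) (u(x := v))"
        using ud v v2 v3 insert.hyps unfolding orthonormal_on_def by auto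
      show "\<forall>j\<in>insert x J. \<forall>i\<in>I. mat_vec I M ((u(x := v)) j) i = of_real ((d(x := c)) j) * (u(x := v)) j i"
        using ud v insert.hyps by auto
    qed
  qed
  from this[OF I order_refl] obtain u d where on: "orthonormal_on I I u"
    and eig: "\<And>j i. j \<in> I \<Longrightarrow> i \<in> I \<Longrightarrow> mat_vec I M (u j) i = of_real (d j :: real) * u j i" by blast
  let ?U = "\<lambda>i k. u k i"
  have U: "unitary_on I ?U" using orthonormal_basis_unitary[OF I on] .
  have "M i j = conj_diag I ?U d i j" if ij: "i \<in> I" "j \<in> I" for i j
  proof -
    have "conj_diag I ?U d i j = (\<Sum>k\<in>I. mat_vec I M (u k) i * cnj (u k j))"
      unfolding conj_diag_def using eig ij by (intro sum.cong refl) (simp add: mult_ac)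
    also have "\<dots> = (\<Sum>k\<in>I. \<Sum>l\<in>I. M i l * (u k l * cnj (u k j)))"
      by (simp add: mat_vec_def sum_distrib_right mult.assoc)
    also have "\<dots> = (\<Sum>l\<in>I. M i l * (\<Sum>k\<in>I. u k l * cnj (u k j)))"
      by (subst sum.swap) (simp add: sum_distrib_left)
    also have "\<dots> = (\<Sum>l\<in>I. M i l * (if l = j then 1 else 0))"
      using U ij by (intro sum.cong refl) (simp add: unitary_on_def op_mult_def op_adj_def)
    also have "\<dots> = M i j" using I ij by (simp add: if_distrib[of "\<lambda>x. _ * x"] cong: if_cong)
    finally show ?thesis by simp
  qed
  then show ?thesis using U unfolding diagonalizes_def by blast
qed

section \<open>Entropy inequalities\<close>

abbreviation (input) col :: "'i opm \<Rightarrow> 'i \<Rightarrow> 'i \<Rightarrow> complex"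
  where "col U k \<equiv> (\<lambda>i. U i k)"

abbreviation tr :: "'i set \<Rightarrow> 'i opm \<Rightarrow> real"
  where "tr I M \<equiv> Re (op_trace I M)"

lemma unitary_on_orthonormal:
  "unitary_on I U \<Longrightarrow> orthonormal_on I I (col U)"
  unfolding unitary_on_def orthonormal_on_def op_mult_def op_adj_def inner_on_def by blast

lemma conj_diag_inner:
  assumes "\<And>i j. i \<in> I \<Longrightarrow> j \<in> I \<Longrightarrow> M i j = conj_diag I U d i j"
  shows "inner_on I v (mat_vec I M v) = of_real (\<Sum>k\<in>I. d k * (cmod (inner_on I (col U k) v))\<^sup>2)"
proof -
  have "inner_on I v (mat_vec I M v)
      = (\<Sum>i\<in>I. \<Sum>j\<in>I. \<Sum>k\<in>I. of_real (d k) * ((cnj (v i) * U i k) * (cnj (U j k) * v j)))"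
    unfolding inner_on_def mat_vec_def sum_distrib_left
  proof (intro sum.cong refl)
    fix i j assume "i \<in> I" "j \<in> I"
    then show "cnj (v i) * (M i j * v j)
        = (\<Sum>k\<in>I. of_real (d k) * ((cnj (v i) * U i k) * (cnj (U j k) * v j)))"
      by (simp add: assms conj_diag_def sum_distrib_left sum_distrib_right mult_ac)
  qed
  also have "\<dots> = (\<Sum>i\<in>I. \<Sum>k\<in>I. \<Sum>j\<in>I. of_real (d k) * ((cnj (v i) * U i k) * (cnj (U j k) * v j)))"
    by (rule sum.cong[OF refl], rule sum.swap)
  also have "\<dots> = (\<Sum>k\<in>I. \<Sum>i\<in>I. \<Sum>j\<in>I. of_real (d k) * ((cnj (v i) * U i k) * (cnj (U j k) * v j)))"
    by (rule sum.swap)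
  also have "\<dots> = (\<Sum>k\<in>I. of_real (d k) * (inner_on I v (col U k) * inner_on I (col U k) v))"
    unfolding inner_on_def sum_product unfolding sum_distrib_left ..
  also have "\<dots> = (\<Sum>k\<in>I. of_real (d k * (cmod (inner_on I (col U k) v))\<^sup>2))"
    by (intro sum.cong refl)
      (simp add: inner_on_cnj[of I "col U _" v, symmetric] complex_norm_square mult.commute
        del: of_real_power)
  finally show ?thesis by simp
qed

lemma diagonalizes_quad_form:
  assumes "diagonalizes I M U d"
  shows "quad_form I M v = (\<Sum>k\<in>I. d k * (cmod (inner_on I (col U k) v))\<^sup>2)"
  using assms unfolding quad_form_def diagonalizes_def by (subst conj_diag_inner[of I M U d]) auto

lemma unitary_on_parseval:
  assumes "finite I" "unitary_on I U"
  shows "(\<Sum>k\<in>I. (cmod (inner_on I (col U k) v))\<^sup>2) = norm2_on I v"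
proof -
  let ?M = "\<lambda>i j. if i = j then 1 else 0"
  have "\<forall>i\<in>I. \<forall>j\<in>I. ?M i j = (\<Sum>k\<in>I. U i k * cnj (U j k))"
    using assms(2) unfolding unitary_on_def op_mult_def op_adj_def by metis
  then have D: "diagonalizes I ?M U (\<lambda>_. 1)"
    using assms(2) unfolding diagonalizes_def conj_diag_def by simp
  have "inner_on I v (mat_vec I ?M v) = inner_on I v v"
    using assms(1) by (intro inner_on_cong) (auto simp: mat_vec_def if_distrib[of "\<lambda>x. x * _"] cong: if_cong)
  then have "quad_form I ?M v = norm2_on I v" by (simp add: quad_form_def inner_on_self)
  then show ?thesis using diagonalizes_quad_form[OF D, of v] by simp
qed

lemma orthonormal_on_norm2: "orthonormal_on I J u \<Longrightarrow> j \<in> J \<Longrightarrow> norm2_on I (u j) = 1"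
  by (metis inner_on_self of_real_eq_1_iff orthonormal_on_def)

lemma diagonalizes_eigenvalue:
  assumes "finite I" "diagonalizes I M U d" "k \<in> I"
  shows "quad_form I M (col U k) = d k"
proof -
  have "orthonormal_on I I (col U)" using assms unitary_on_orthonormal unfolding diagonalizes_def by blast
  then have "quad_form I M (col U k) = (\<Sum>l\<in>I. if l = k then d l else 0)"
    unfolding diagonalizes_quad_form[OF assms(2)] orthonormal_on_def
    using assms(3) by (intro sum.cong refl) simp
  then show ?thesis using assms by simp
qed

lemma diagonalizes_trace:
  assumes "finite I" "unitary_on I U" "\<And>i. i \<in> I \<Longrightarrow> M i i = conj_diag I U d i i"
  shows "op_trace I M = of_real (\<Sum>k\<in>I. d k)"
proof -
  have "op_trace I M = (\<Sum>i\<in>I. \<Sum>k\<in>I. of_real (d k) * (cnj (U i k) * U i k))"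
    unfolding op_trace_def using assms(3) by (intro sum.cong refl) (simp add: conj_diag_def mult_ac)
  also have "\<dots> = (\<Sum>k\<in>I. of_real (d k) * inner_on I (col U k) (col U k))"
    by (subst sum.swap) (simp add: inner_on_def sum_distrib_left)
  also have "\<dots> = (\<Sum>k\<in>I. of_real (d k))"
    using unitary_on_orthonormal[OF assms(2)] by (intro sum.cong refl) (simp add: orthonormal_on_def)
  finally show ?thesis by simp
qed

lemma conj_diag_mult:
  assumes "finite I" "unitary_on I U"
  shows "op_mult I (conj_diag I U f) (conj_diag I U g) = conj_diag I U (\<lambda>k. f k * g k)"
proof (intro ext)
  fix i j
  have "op_mult I (conj_diag I U f) (conj_diag I U g) i j
      = (\<Sum>l\<in>I. \<Sum>k\<in>I. \<Sum>m\<in>I. (U i k * of_real (f k) * (of_real (g m) * cnj (U j m))) * (cnj (U l k) * U l m))"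
    by (simp add: op_mult_def conj_diag_def sum_product mult_ac)
  also have "\<dots> = (\<Sum>k\<in>I. \<Sum>m\<in>I. \<Sum>l\<in>I. (U i k * of_real (f k) * (of_real (g m) * cnj (U j m))) * (cnj (U l k) * U l m))"
    by (subst sum.swap, rule sum.cong[OF refl], subst sum.swap) (rule refl)
  also have "\<dots> = (\<Sum>k\<in>I. \<Sum>m\<in>I. (U i k * of_real (f k) * (of_real (g m) * cnj (U j m))) * (if k = m then 1 else 0))"
    using unitary_on_orthonormal[OF assms(2)]
    by (intro sum.cong refl) (simp add: orthonormal_on_def inner_on_def flip: sum_distrib_left)
  also have "\<dots> = conj_diag I U (\<lambda>k. f k * g k) i j"
    using assms(1) by (simp add: conj_diag_def if_distrib[of "\<lambda>x. _ * x"] mult_ac cong: if_cong)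
  finally show "op_mult I (conj_diag I U f) (conj_diag I U g) i j = conj_diag I U (\<lambda>k. f k * g k) i j" .
qed

lemma op_mult_cong:
  "(\<And>k. k \<in> I \<Longrightarrow> M i k = M' i k) \<Longrightarrow> (\<And>k. k \<in> I \<Longrightarrow> N k j = N' k j) \<Longrightarrow>
    op_mult I M N i j = op_mult I M' N' i j"
  by (simp add: op_mult_def)

text \<open>Extracting the very pair that \<open>SOME\<close> picks yields a single eigenbasis for
  all functions \<open>f\<close> simultaneously.\<close>

lemma op_fun_diagonalization:
  assumes "finite I" "hermitian_on I M"
  obtains U d where "diagonalizes I M U d" "\<And>f. op_fun I f M = conj_diag I U (\<lambda>k. f (d k))"
proof -
  obtain U d where Ud: "(SOME (U, d). diagonalizes I M U d) = (U, d)" by fastforce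
  have "\<exists>p. case p of (U, d) \<Rightarrow> diagonalizes I M U d"
    using spectral_theorem_on[OF assms] by auto
  then have "diagonalizes I M U d"
    using someI_ex[of "\<lambda>(U, d). diagonalizes I M U d"] Ud by auto
  moreover have "op_fun I f M = conj_diag I U (\<lambda>k. f (d k))" for f
    by (simp add: op_fun_def Ud)
  ultimately show ?thesis using that by blast
qed

lemma entropy_diagonalization:
  assumes "finite I" "psd_on I M"
  obtains U d where "diagonalizes I M U d" "\<And>k. k \<in> I \<Longrightarrow> 0 \<le> d k"
    "vn_entropy I M = - (\<Sum>k\<in>I. d k * log 2 (d k))" "tr I M = (\<Sum>k\<in>I. d k)"
proof -
  have "hermitian_on I M" using assms psd_on_iff by blast
  then obtain U d where Ud: "diagonalizes I M U d"
    and f: "\<And>f. op_fun I f M = conj_diag I U (\<lambda>k. f (d k))"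
    using op_fun_diagonalization assms by blast
  have U: "unitary_on I U" and M: "\<And>i j. i \<in> I \<Longrightarrow> j \<in> I \<Longrightarrow> M i j = conj_diag I U d i j"
    using Ud by (auto simp: diagonalizes_def)
  have "0 \<le> d k" if "k \<in> I" for k
    using diagonalizes_eigenvalue[OF assms(1) Ud that] assms(2) by (metis psd_on_iff)
  moreover have "op_trace I (op_mult I M (op_fun I (log 2) M)) = of_real (\<Sum>k\<in>I. d k * log 2 (d k))"
  proof (rule diagonalizes_trace[OF assms(1) U])
    fix i assume "i \<in> I"
    then show "op_mult I M (op_fun I (log 2) M) i i = conj_diag I U (\<lambda>k. d k * log 2 (d k)) i i"
      unfolding conj_diag_mult[OF assms(1) U, symmetric] f using M by (intro op_mult_cong) auto
  qed
  then have "vn_entropy I M = - (\<Sum>k\<in>I. d k * log 2 (d k))"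
    unfolding vn_entropy_def by simp
  moreover have "op_trace I M = of_real (\<Sum>k\<in>I. d k)"
    using diagonalizes_trace[OF assms(1) U, of M d] M by simp
  ultimately show ?thesis using that Ud by simp
qed

lemma tr_nonneg:
  assumes "finite I" "psd_on I M"
  shows "0 \<le> tr I M"
  using entropy_diagonalization[OF assms] by (metis sum_nonneg)

section \<open>Monotonicity of the logarithm and Klein's inequality\<close>

text \<open>\<open>z\<close> and \<open>W\<close> describe the operator \<open>Z\<close> with eigenvalues \<open>z k\<close> and eigenvectors \<open>col W k\<close>; the
  sum is \<open>Tr X log Z\<close>. The lower bound is monotonicity of the logarithm on \<open>X \<le> c Z\<close>, the upper
  bound is Klein's inequality for \<open>X\<close> and \<open>a Z\<close>.\<close>

lemma entropy_cross_bounds: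
  assumes I: "finite I" and X: "psd_on I X" and W: "unitary_on I W"
    and z: "\<And>k. k \<in> I \<Longrightarrow> 0 \<le> z k" and c: "0 < c"
    and le: "\<And>v. quad_form I X v \<le> c * (\<Sum>k\<in>I. z k * (cmod (inner_on I (col W k) v))\<^sup>2)"
  shows "- (\<Sum>k\<in>I. quad_form I X (col W k) * log 2 (z k)) - log 2 c * tr I X \<le> vn_entropy I X"
    and "0 < a \<Longrightarrow> vn_entropy I X \<le> - (\<Sum>k\<in>I. quad_form I X (col W k) * log 2 (z k))
      - log 2 a * tr I X + (a * (\<Sum>k\<in>I. z k) - tr I X) / ln 2"
proof -
  obtain U x where Ux: "diagonalizes I X U x" and x: "\<And>k. k \<in> I \<Longrightarrow> 0 \<le> x k"
    and S: "vn_entropy I X = - (\<Sum>k\<in>I. x k * log 2 (x k))" and T: "tr I X = (\<Sum>k\<in>I. x k)"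
    using entropy_diagonalization[OF I X] by blast
  have U: "unitary_on I U" using Ux by (simp add: diagonalizes_def)
  have oW: "orthonormal_on I I (col W)" and oU: "orthonormal_on I I (col U)"
    using unitary_on_orthonormal W U by auto
  define p where "p j k = (cmod (inner_on I (col U j) (col W k)))\<^sup>2" for j k
  have p_alt: "p j k = (cmod (inner_on I (col W k) (col U j)))\<^sup>2" for j k
    unfolding p_def by (metis complex_mod_cnj inner_on_cnj)
  have p0: "0 \<le> p j k" for j k by (simp add: p_def)
  have row: "(\<Sum>k\<in>I. p j k) = 1" if "j \<in> I" for j
    unfolding p_alt using unitary_on_parseval[OF I W] orthonormal_on_norm2[OF oU that] by simp
  have column: "(\<Sum>j\<in>I. p j k) = 1" if "k \<in> I" for k
    unfolding p_def using unitary_on_parseval[OF I U] orthonormal_on_norm2[OF oW that] by simp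
  have qf: "quad_form I X (col W k) = (\<Sum>j\<in>I. x j * p j k)" for k
    unfolding p_def by (rule diagonalizes_quad_form[OF Ux])
  \<comment> \<open>By \<open>X \<le> c Z\<close>, \<open>X\<close> vanishes on the kernel of
    \<open>Z\<close>. Hence \<open>log 2 0\<close>, whatever its value, always carries weight
    zero.\<close>
  have zero: "x j * p j k = 0" if "j \<in> I" "k \<in> I" "z k = 0" for j k
  proof -
    have "(\<Sum>l\<in>I. z l * (cmod (inner_on I (col W l) (col W k)))\<^sup>2) = 0"
      using oW that by (intro sum.neutral) (auto simp: orthonormal_on_def)
    then have "(\<Sum>j\<in>I. x j * p j k) \<le> 0" using le[of "col W k"] qf[of k] by simp
    moreover have "x j * p j k \<le> (\<Sum>j\<in>I. x j * p j k)"
      using that I x p0 by (intro member_le_sum) auto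
    moreover have "0 \<le> x j * p j k" using x[OF that(1)] p0 by simp
    ultimately show ?thesis by linarith
  qed
  have S': "vn_entropy I X = - (\<Sum>j\<in>I. \<Sum>k\<in>I. x j * p j k * log 2 (x j))"
    unfolding S using row by (simp add: mult.commute[of _ "log 2 _"] mult.assoc flip: sum_distrib_left)
  have C: "(\<Sum>k\<in>I. quad_form I X (col W k) * log 2 (z k)) = (\<Sum>j\<in>I. \<Sum>k\<in>I. x j * p j k * log 2 (z k))"
    unfolding qf sum_distrib_right by (rule sum.swap)
  have T': "tr I X = (\<Sum>j\<in>I. \<Sum>k\<in>I. x j * p j k)"
    unfolding T using row by (simp flip: sum_distrib_left)
  have Z': "(\<Sum>k\<in>I. z k) = (\<Sum>j\<in>I. \<Sum>k\<in>I. z k * p j k)"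
    by (subst sum.swap) (simp add: column flip: sum_distrib_left)
  have "(\<Sum>k\<in>I. x j * p j k * (log 2 (x j) - log 2 (z k) - log 2 c)) \<le> 0" if j: "j \<in> I" for j
  proof (cases "x j = 0")
    case False
    then have xj: "x j > 0" using x[OF j] by simp
    \<comment> \<open>With the convention that division by 0 gives 0, \<open>v\<close> is the
      pseudoinverse of \<open>Z\<close> applied to the eigenvector \<open>col U j\<close>, and
      \<open>s\<close> is the expectation of that pseudoinverse in \<open>col U j\<close>. Testing
      \<open>X \<le> c Z\<close> on \<open>v\<close> gives
      \<open>x j * s\<^sup>2 \<le> c * s\<close>, hence \<open>x j * s \<le> c\<close>: the inverse
      reverses the order.\<close>
    define s where "s = (\<Sum>k\<in>I. p j k / z k)"
    have s0: "0 \<le> s" unfolding s_def using p0 z by (intro sum_nonneg) auto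
    define v where "v i = (\<Sum>k\<in>I. (inner_on I (col W k) (col U j) / of_real (z k)) * W i k)" for i
    have iv: "inner_on I w v = (\<Sum>k\<in>I. (inner_on I (col W k) (col U j) / of_real (z k)) * inner_on I w (col W k))" for w
      unfolding v_def inner_on_sum_right inner_on_scale_right ..
    have "inner_on I (col W l) v = inner_on I (col W l) (col U j) / of_real (z l)" if "l \<in> I" for l
      unfolding iv using I oW that
      by (simp add: orthonormal_on_def if_distrib[of "\<lambda>x. _ * x"] cong: if_cong)
    then have "(\<Sum>k\<in>I. z k * (cmod (inner_on I (col W k) v))\<^sup>2) = s"
      unfolding s_def p_alt
      by (intro sum.cong refl) (simp add: norm_divide power_divide power2_eq_square[of "z _"])
    moreover have "inner_on I (col U j) v = of_real s"
      unfolding iv s_def of_real_sum p_alt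
      by (intro sum.cong refl)
        (simp add: complex_norm_square inner_on_cnj[of I "col W _" "col U j"] mult.commute del: of_real_power)
    then have "x j * s\<^sup>2 \<le> quad_form I X v"
      unfolding diagonalizes_quad_form[OF Ux] using I j x
      by (intro order_trans[OF _ member_le_sum[OF j]]) auto
    ultimately have "x j * s\<^sup>2 \<le> c * s" using le[of v] by simp
    then have xs: "x j * s \<le> c"
      using s0 c by (cases "s = 0") (auto simp: power2_eq_square mult_le_cancel_right simp flip: mult.assoc)
    have "(\<Sum>k\<in>I. x j * p j k * (log 2 (x j) - log 2 (z k) - log 2 c))
        \<le> (\<Sum>k\<in>I. x j / ln 2 * (x j / c * (p j k / z k) - p j k))"
    proof (intro sum_mono)
      fix k assume k: "k \<in> I"
      show "x j * p j k * (log 2 (x j) - log 2 (z k) - log 2 c)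
        \<le> x j / ln 2 * (x j / c * (p j k / z k) - p j k)"
      proof (cases "z k = 0")
        case True
        then show ?thesis using zero[OF j k] xj by simp
      next
        case False
        then have zk: "z k > 0" using z[OF k] by simp
        \<comment> \<open>This tangent bound replaces concavity: weighted by \<open>p j k\<close>
          and summed over \<open>k\<close>, which has total weight 1, its right side becomes
          \<open>x j * s / c - 1\<close>, and this is at most 0.\<close>
        have "ln (x j / (c * z k)) \<le> x j / (c * z k) - 1"
          using xj zk c by (intro ln_le_minus_one) simp
        then have "ln (x j) - ln (z k) - ln c \<le> x j / (c * z k) - 1"
          using xj zk c by (simp add: ln_div ln_mult)
        then have "x j * p j k / ln 2 * (ln (x j) - ln (z k) - ln c) \<le> x j * p j k / ln 2 * (x j / (c * z k) - 1)"
          using xj p0 by (intro mult_left_mono) auto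
        moreover have "x j * p j k / ln 2 * (ln (x j) - ln (z k) - ln c)
            = x j * p j k * (log 2 (x j) - log 2 (z k) - log 2 c)"
          by (simp add: log_def diff_divide_distrib[symmetric])
        moreover have "x j * p j k / ln 2 * (x j / (c * z k) - 1) = x j / ln 2 * (x j / c * (p j k / z k) - p j k)"
          using zk c by (simp add: divide_simps) (simp add: algebra_simps)
        ultimately show ?thesis by linarith
      qed
    qed
    also have "\<dots> = x j / ln 2 * (x j / c * s - 1)"
      by (simp only: sum_distrib_left[symmetric] sum_subtractf row[OF j] s_def)
    also have "\<dots> \<le> 0"
      using xs c xj by (intro mult_nonneg_nonpos) (auto simp: field_simps)
    finally show ?thesis .
  qed simp
  then have "(\<Sum>j\<in>I. \<Sum>k\<in>I. x j * p j k * (log 2 (x j) - log 2 (z k) - log 2 c)) \<le> 0"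
    by (rule sum_nonpos)
  then show "- (\<Sum>k\<in>I. quad_form I X (col W k) * log 2 (z k)) - log 2 c * tr I X \<le> vn_entropy I X"
    unfolding S' C T' by (simp add: right_diff_distrib sum_subtractf sum_distrib_left mult.commute[of "log 2 c"])
  assume a: "0 < a"
  have "(\<Sum>j\<in>I. \<Sum>k\<in>I. - (x j * p j k * log 2 (x j)))
    \<le> (\<Sum>j\<in>I. \<Sum>k\<in>I. - (x j * p j k * log 2 (z k)) - log 2 a * (x j * p j k)
        + (a * (z k * p j k) - x j * p j k) / ln 2)"
  proof (intro sum_mono)
    fix j k assume jk: "j \<in> I" "k \<in> I"
    show "- (x j * p j k * log 2 (x j)) \<le> - (x j * p j k * log 2 (z k)) - log 2 a * (x j * p j k)
        + (a * (z k * p j k) - x j * p j k) / ln 2"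
    proof (cases "x j * p j k = 0")
      case True
      then have "0 \<le> (a * (z k * p j k) - x j * p j k) / ln 2"
        unfolding True using a p0[of j k] z[OF jk(2)] by simp
      then show ?thesis unfolding True by simp
    next
      case False
      then have pos: "x j > 0" "p j k > 0" "z k > 0"
        using x[OF jk(1)] z[OF jk(2)] p0[of j k] zero[OF jk] by (auto simp: order.strict_iff_order)
      \<comment> \<open>Klein's inequality reduces to the same tangent bound for each pair of
        eigenvectors. Since \<open>p\<close> is doubly stochastic, the linear terms add up to
        \<open>a\<close> Tr Z - Tr X.\<close>
      have "ln (a * z k / x j) \<le> a * z k / x j - 1" using pos a by (intro ln_le_minus_one) simp
      then have "ln a + ln (z k) - ln (x j) \<le> a * z k / x j - 1"
        using pos a by (simp add: ln_div ln_mult)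
      then have "x j * p j k / ln 2 * (ln a + ln (z k) - ln (x j)) \<le> x j * p j k / ln 2 * (a * z k / x j - 1)"
        using pos by (intro mult_left_mono) auto
      moreover have "x j * p j k / ln 2 * (ln a + ln (z k) - ln (x j))
          = log 2 a * (x j * p j k) + x j * p j k * log 2 (z k) - x j * p j k * log 2 (x j)"
        by (simp add: log_def algebra_simps add_divide_distrib diff_divide_distrib)
      moreover have "x j * p j k / ln 2 * (a * z k / x j - 1) = (a * (z k * p j k) - x j * p j k) / ln 2"
        using pos by (simp add: divide_simps) (simp add: algebra_simps)
      ultimately show ?thesis by linarith
    qed
  qed
  then show "vn_entropy I X \<le> - (\<Sum>k\<in>I. quad_form I X (col W k) * log 2 (z k))
      - log 2 a * tr I X + (a * (\<Sum>k\<in>I. z k) - tr I X) / ln 2"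
    unfolding S' C T' Z'
    by (simp add: sum.distrib sum_subtractf sum_negf flip: sum_distrib_left sum_divide_distrib)
qed

section \<open>Near-additivity of the entropy\<close>

lemma inner_on_mat_vec_add:
  "inner_on I v (mat_vec I (\<lambda>i j. X i j + Y i j) v)
    = inner_on I v (mat_vec I X v) + inner_on I v (mat_vec I Y v)"
  by (simp add: inner_on_def mat_vec_def algebra_simps sum.distrib)

lemma quad_form_add: "quad_form I (\<lambda>i j. X i j + Y i j) v = quad_form I X v + quad_form I Y v"
  by (simp add: quad_form_def inner_on_mat_vec_add)

lemma quad_form_scale: "quad_form I (\<lambda>i j. of_real c * X i j) v = c * quad_form I X v"
proof -
  have "mat_vec I (\<lambda>i j. of_real c * X i j) v = (\<lambda>i. of_real c * mat_vec I X v i)"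
    by (simp add: mat_vec_def sum_distrib_left mult.assoc)
  then show ?thesis by (simp add: quad_form_def inner_on_scale_right)
qed

lemma hermitian_on_add:
  "hermitian_on I X \<Longrightarrow> hermitian_on I Y \<Longrightarrow> hermitian_on I (\<lambda>i j. X i j + Y i j)"
  unfolding hermitian_on_def complex_cnj_add by (intro ballI arg_cong2[where f="(+)"]) blast+

lemma hermitian_on_scale: "hermitian_on I X \<Longrightarrow> hermitian_on I (\<lambda>i j. of_real c * X i j)"
  unfolding hermitian_on_def complex_cnj_mult complex_cnj_complex_of_real
  by (intro ballI arg_cong2[where f="(*)"] refl) blast

lemma psd_on_add: "psd_on I X \<Longrightarrow> psd_on I Y \<Longrightarrow> psd_on I (\<lambda>i j. X i j + Y i j)"
  unfolding psd_on_iff quad_form_add using hermitian_on_add by (metis add_nonneg_nonneg)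

lemma psd_on_scale: "psd_on I X \<Longrightarrow> 0 \<le> c \<Longrightarrow> psd_on I (\<lambda>i j. of_real c * X i j)"
  unfolding psd_on_iff quad_form_scale using hermitian_on_scale by (metis mult_nonneg_nonneg)

lemma op_trace_add: "op_trace I (\<lambda>i j. X i j + Y i j) = op_trace I X + op_trace I Y"
  by (simp add: op_trace_def sum.distrib)

lemma op_trace_scale: "op_trace I (\<lambda>i j. c * X i j) = c * op_trace I X"
  by (simp add: op_trace_def sum_distrib_left)

text \<open>The excess in Klein's inequality with parameter \<open>m\<close>: - m log m, plus
  \<open>m\<close> times the bound 3 on the total trace.\<close>

definition entropy_err :: "real \<Rightarrow> real"
  where "entropy_err m = m * (3 - ln m) / ln 2"

text \<open>For Z = X + Y, - Tr Z log Z splits exactly into the cross terms \<open>CX\<close> and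
  \<open>CY\<close>. Every error comes from replacing log Z by log X or by log Y in one of
  them.\<close>

lemma entropy_almost_additive:
  assumes I: "finite I" and X: "psd_on I X" and Y: "psd_on I Y"
    and m: "tr I Y \<le> m" "0 < m" "m \<le> 1" and t: "tr I X + tr I Y \<le> 3"
  shows "\<bar>vn_entropy I (\<lambda>i j. X i j + Y i j) - vn_entropy I X - vn_entropy I Y\<bar> \<le> entropy_err m"
proof -
  let ?Z = "\<lambda>i j. X i j + Y i j"
  have Z: "psd_on I ?Z" using X Y by (rule psd_on_add)
  obtain W z where Wz: "diagonalizes I ?Z W z" and z: "\<And>k. k \<in> I \<Longrightarrow> 0 \<le> z k"
    and S: "vn_entropy I ?Z = - (\<Sum>k\<in>I. z k * log 2 (z k))" and T: "tr I ?Z = (\<Sum>k\<in>I. z k)"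
    using entropy_diagonalization[OF I Z] by blast
  have W: "unitary_on I W" using Wz by (simp add: diagonalizes_def)
  have pos: "0 \<le> quad_form I X v" "0 \<le> quad_form I Y v" for v using X Y by (auto simp: psd_on_iff)
  have qZ: "quad_form I ?Z v = (\<Sum>k\<in>I. z k * (cmod (inner_on I (\<lambda>i. W i k) v))\<^sup>2)" for v
    by (rule diagonalizes_quad_form[OF Wz])
  have leX: "quad_form I X v \<le> 1 * (\<Sum>k\<in>I. z k * (cmod (inner_on I (\<lambda>i. W i k) v))\<^sup>2)"
    and leY: "quad_form I Y v \<le> 1 * (\<Sum>k\<in>I. z k * (cmod (inner_on I (\<lambda>i. W i k) v))\<^sup>2)" for v
    using pos[of v] unfolding qZ[symmetric] quad_form_add by simp_all
  define CX where "CX = - (\<Sum>k\<in>I. quad_form I X (\<lambda>i. W i k) * log 2 (z k))"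
  define CY where "CY = - (\<Sum>k\<in>I. quad_form I Y (\<lambda>i. W i k) * log 2 (z k))"
  have "vn_entropy I ?Z = - (\<Sum>k\<in>I. quad_form I ?Z (\<lambda>i. W i k) * log 2 (z k))"
    unfolding S using diagonalizes_eigenvalue[OF I Wz] by simp
  then have SZ: "vn_entropy I ?Z = CX + CY"
    by (simp add: CX_def CY_def quad_form_add algebra_simps sum.distrib)
  have trz: "(\<Sum>k\<in>I. z k) = tr I X + tr I Y"
    unfolding T[symmetric] op_trace_add by simp
  note bX = entropy_cross_bounds[OF I X W z zero_less_one leX, folded CX_def, unfolded trz]
  note bY = entropy_cross_bounds[OF I Y W z zero_less_one leY, folded CY_def, unfolded trz]
  have low: "CX + CY \<le> vn_entropy I X + vn_entropy I Y" using bX(1) bY(1) by simp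
  have upX: "vn_entropy I X \<le> CX + tr I Y / ln 2" using bX(2)[of 1] by simp
  \<comment> \<open>The parameter is 1 for \<open>X\<close> but \<open>m\<close> for
    \<open>Y\<close>: parameter 1 would leave Tr X here, which is not small. The terms Tr Y / ln 2
    of the two bounds cancel on addition.\<close>
  have upY: "vn_entropy I Y \<le> CY - log 2 m * tr I Y + (m * (tr I X + tr I Y) - tr I Y) / ln 2"
    using bY(2)[of m] m by simp
  have "- log 2 m * tr I Y \<le> - log 2 m * m"
    using m by (intro mult_left_mono) (auto simp: log_le_zero_cancel_iff)
  moreover have "m * (tr I X + tr I Y) / ln 2 \<le> m * 3 / ln 2"
    using m t by (intro divide_right_mono mult_left_mono) auto
  ultimately have "vn_entropy I X + vn_entropy I Y \<le> CX + CY - log 2 m * m + m * 3 / ln 2"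
    using upX upY by (simp add: diff_divide_distrib)
  also have "\<dots> = CX + CY + entropy_err m"
    by (simp add: entropy_err_def log_def field_simps)
  finally show ?thesis unfolding SZ using low by simp
qed

lemma entropy_err_tendsto: "(entropy_err \<longlongrightarrow> 0) (at_right 0)"
proof -
  have "((\<lambda>x::real. x * ln x) \<longlongrightarrow> 0) (at_right 0)"
  proof (rule tendsto_sandwich)
    show "\<forall>\<^sub>F x::real in at_right 0. - 2 * sqrt x \<le> x * ln x"
      using eventually_at_right_less[of 0]
    proof eventually_elim
      case (elim x)
      have "ln (1 / sqrt x) \<le> 1 / sqrt x - 1" using elim by (intro ln_le_minus_one) simp
      then have "- ln x \<le> 2 * (1 / sqrt x)" using elim by (simp add: ln_div ln_sqrt)
      then have "x * - ln x \<le> x * (2 * (1 / sqrt x))" using elim by (intro mult_left_mono) auto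
      also have "\<dots> = 2 * sqrt x" using elim by (simp add: field_simps)
      finally show ?case by simp
    qed
    show "\<forall>\<^sub>F x::real in at_right 0. x * ln x \<le> 0"
      using eventually_at_right_real[of 0 1, OF zero_less_one]
      by eventually_elim (auto simp: mult_nonneg_nonpos)
    have "((\<lambda>x::real. - 2 * sqrt x) \<longlongrightarrow> - 2 * sqrt 0) (at_right 0)"
      by (intro tendsto_intros)
    then show "((\<lambda>x::real. - 2 * sqrt x) \<longlongrightarrow> 0) (at_right 0)" by simp
  qed simp
  then have "((\<lambda>m::real. (m * 3 - m * ln m) / ln 2) \<longlongrightarrow> (0 * 3 - 0) / ln 2) (at_right 0)"
    by (intro tendsto_intros) auto
  then show ?thesis by (simp add: entropy_err_def[abs_def] right_diff_distrib)
qed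

section \<open>Comparing an entropy with that of a partial trace\<close>

text \<open>The index set \<open>J\<close> of the composite system is identified with the pairs \<open>(i, b)\<close>, \<open>i \<in> I\<close>, through
  the bijection \<open>g\<close>, so that the same facts serve for tracing out from \<open>ABE\<close> and from \<open>BE\<close>.\<close>

locale partial_trace =
  fixes I :: "'i set" and J :: "'j set" and g :: "'i \<Rightarrow> 'b::finite \<Rightarrow> 'j"
    and \<pi> :: "'j \<Rightarrow> 'i" and \<beta> :: "'j \<Rightarrow> 'b" and X :: "'j opm"
  assumes fin: "finite I" and J: "J = (\<lambda>(i, b). g i b) ` (I \<times> UNIV)"
    and g1: "\<And>i b. \<pi> (g i b) = i" and g2: "\<And>i b. \<beta> (g i b) = b"
    and X: "psd_on J X"
begin

definition Y :: "'i opm"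
  where "Y = (\<lambda>i i'. \<Sum>b\<in>UNIV. X (g i b) (g i' b))"

text \<open>The product vector of \<open>w\<close> with the basis vector \<open>b\<close> of the
  factor that is traced out.\<close>

definition emb :: "'b \<Rightarrow> ('i \<Rightarrow> complex) \<Rightarrow> 'j \<Rightarrow> complex"
  where "emb b w = (\<lambda>j. if \<beta> j = b then w (\<pi> j) else 0)"

lemma fin_J: "finite J" using fin by (simp add: J)

lemma sum_J: "(\<Sum>j\<in>J. f j) = (\<Sum>i\<in>I. \<Sum>b\<in>UNIV. f (g i b))"
proof -
  have "inj_on (\<lambda>(i, b). g i b) (I \<times> UNIV)"
    by (intro inj_onI) (clarsimp, metis g1 g2)
  then show ?thesis
    by (simp add: J sum.reindex sum.cartesian_product o_def case_prod_unfold)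
qed

lemma inner_emb: "inner_on J (emb b w) v = inner_on I w (\<lambda>i. v (g i b))"
  by (simp add: inner_on_def sum_J emb_def g1 g2 if_distrib[of cnj] if_distrib[of "\<lambda>x. x * _"] cong: if_cong)

lemma inner_emb_emb: "inner_on J (emb b w) (emb b' w') = (if b = b' then inner_on I w w' else 0)"
  unfolding inner_emb by (simp add: emb_def g1 g2 inner_on_def)

lemma inner_Y: "inner_on I w (mat_vec I Y w) = (\<Sum>b\<in>UNIV. inner_on J (emb b w) (mat_vec J X (emb b w)))"
proof -
  have *: "inner_on J (emb b w) (mat_vec J X (emb b w))
      = (\<Sum>i\<in>I. \<Sum>i'\<in>I. cnj (w i) * X (g i b) (g i' b) * w i')" for b
    unfolding inner_emb
    by (simp add: inner_on_def mat_vec_def sum_J emb_def g1 g2 sum_distrib_left mult.assoc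
        if_distrib[of "\<lambda>x. _ * x"] cong: if_cong)
  have "inner_on I w (mat_vec I Y w) = (\<Sum>i\<in>I. \<Sum>i'\<in>I. \<Sum>b\<in>UNIV. cnj (w i) * X (g i b) (g i' b) * w i')"
    by (simp add: inner_on_def mat_vec_def Y_def sum_distrib_left sum_distrib_right mult.assoc)
  also have "\<dots> = (\<Sum>i\<in>I. \<Sum>b\<in>UNIV. \<Sum>i'\<in>I. cnj (w i) * X (g i b) (g i' b) * w i')"
    by (rule sum.cong[OF refl], rule sum.swap)
  also have "\<dots> = (\<Sum>b\<in>UNIV. \<Sum>i\<in>I. \<Sum>i'\<in>I. cnj (w i) * X (g i b) (g i' b) * w i')"
    by (rule sum.swap)
  finally show ?thesis by (simp only: *)
qed

lemma quad_form_Y: "quad_form I Y w = (\<Sum>b\<in>UNIV. quad_form J X (emb b w))"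
  by (simp add: quad_form_def inner_Y)

lemma psd_Y: "psd_on I Y"
  unfolding psd_on_iff
proof (intro conjI allI)
  show "hermitian_on I Y"
    unfolding hermitian_on_def
  proof (intro ballI)
    fix i i' assume i: "i \<in> I" "i' \<in> I"
    have "g i b \<in> J" "g i' b \<in> J" for b using i by (auto simp: J)
    then have "X (g i b) (g i' b) = cnj (X (g i' b) (g i b))" for b
      using X unfolding psd_on_def hermitian_on_def by blast
    then show "Y i i' = cnj (Y i' i)" unfolding Y_def cnj_sum by (rule sum.cong[OF refl])
  qed
  show "0 \<le> quad_form I Y v" for v
    unfolding quad_form_Y using X by (intro sum_nonneg) (auto simp: psd_on_iff)
qed

lemma trace_Y: "op_trace I Y = op_trace J X"
  by (simp add: op_trace_def Y_def sum_J)

text \<open>The pinching inequality. Each eigenvector of \<open>X\<close> sees \<open>v\<close> as a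
  sum of its \<open>CARD('b)\<close> blocks, and Cauchy-Schwarz over the blocks costs that
  factor.\<close>

lemma quad_form_pinching:
  "quad_form J X v \<le> real CARD('b) * (\<Sum>b\<in>UNIV. quad_form J X (emb b (\<lambda>i. v (g i b))))"
proof -
  obtain U x where Ux: "diagonalizes J X U x" and x: "\<And>k. k \<in> J \<Longrightarrow> 0 \<le> x k"
    using entropy_diagonalization[OF fin_J X] by blast
  let ?e = "\<lambda>b. emb b (\<lambda>i. v (g i b))"
  have "inner_on J u v = inner_on J u (\<lambda>j. \<Sum>b\<in>UNIV. ?e b j)" for u
    by (intro inner_on_cong) (auto simp: J emb_def g1 g2)
  then have dec: "inner_on J u v = (\<Sum>b\<in>UNIV. inner_on J u (?e b))" for u
    by (simp add: inner_on_sum_right)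
  have "(cmod (inner_on J u v))\<^sup>2 \<le> real CARD('b) * (\<Sum>b\<in>UNIV. (cmod (inner_on J u (?e b)))\<^sup>2)" for u
  proof -
    have "(cmod (inner_on J u v))\<^sup>2 \<le> (\<Sum>b\<in>UNIV. 1 * cmod (inner_on J u (?e b)))\<^sup>2"
      unfolding dec by (intro power_mono) (auto simp: norm_sum)
    also have "\<dots> \<le> (\<Sum>b\<in>(UNIV::'b set). 1\<^sup>2) * (\<Sum>b\<in>UNIV. (cmod (inner_on J u (?e b)))\<^sup>2)"
      by (rule Cauchy_Schwarz_ineq_sum)
    finally show ?thesis by simp
  qed
  then have "quad_form J X v \<le> (\<Sum>k\<in>J. x k * (real CARD('b) * (\<Sum>b\<in>UNIV. (cmod (inner_on J (\<lambda>i. U i k) (?e b)))\<^sup>2)))"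
    unfolding diagonalizes_quad_form[OF Ux] using x by (intro sum_mono mult_left_mono) auto
  also have "\<dots> = real CARD('b) * (\<Sum>b\<in>UNIV. quad_form J X (?e b))"
    unfolding diagonalizes_quad_form[OF Ux]
    by (subst sum.swap) (simp add: sum_distrib_left mult_ac)
  finally show ?thesis .
qed

text \<open>The comparison operator is \<open>Y\<close> tensored with the identity: eigenvectors
  \<open>w j\<close>, eigenvalues \<open>y (\<pi> j)\<close>. Pinching bounds \<open>X\<close> by
  \<open>CARD('b)\<close> times this operator, its cross term with \<open>X\<close> is exactly
  \<open>- vn_entropy I Y\<close>, and its trace is \<open>CARD('b)\<close> times that of
  \<open>X\<close>.\<close>

lemma entropy_partial_trace:
  "\<bar>vn_entropy J X - vn_entropy I Y\<bar> \<le> real CARD('b) / ln 2 * tr J X"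
proof -
  obtain V y where Vy: "diagonalizes I Y V y" and y: "\<And>k. k \<in> I \<Longrightarrow> 0 \<le> y k"
    and S: "vn_entropy I Y = - (\<Sum>k\<in>I. y k * log 2 (y k))" and T: "tr I Y = (\<Sum>k\<in>I. y k)"
    using entropy_diagonalization[OF fin psd_Y] by blast
  have oV: "orthonormal_on I I (\<lambda>k i. V i k)"
    using Vy unitary_on_orthonormal unfolding diagonalizes_def by blast
  define w where "w j = emb (\<beta> j) (\<lambda>i. V i (\<pi> j))" for j
  define W where "W = (\<lambda>j k. w k j)"
  have w: "w (g i b) = emb b (\<lambda>l. V l i)" for i b by (simp add: w_def g1 g2)
  have "orthonormal_on J J w"
    unfolding orthonormal_on_def
  proof (intro ballI)
    fix j k assume "j \<in> J" "k \<in> J"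
    then obtain i b i' b' where "j = g i b" "k = g i' b'" "i \<in> I" "i' \<in> I" by (auto simp: J)
    moreover from this have "j = k \<longleftrightarrow> i = i' \<and> b = b'" by (metis g1 g2)
    ultimately show "inner_on J (w j) (w k) = (if j = k then 1 else 0)"
      using oV by (auto simp: w inner_emb_emb orthonormal_on_def)
  qed
  then have W: "unitary_on J W" unfolding W_def by (rule orthonormal_basis_unitary[OF fin_J])
  let ?z = "\<lambda>j. y (\<pi> j)" and ?d = "real CARD('b)"
  have d: "1 \<le> ?d" using zero_less_card_finite[where 'a='b] by linarith
  have z: "0 \<le> ?z j" if "j \<in> J" for j using that y by (auto simp: J g1)
  have qY: "(\<Sum>j\<in>J. ?z j * (cmod (inner_on J (\<lambda>i. W i j) v))\<^sup>2) = (\<Sum>b\<in>UNIV. quad_form I Y (\<lambda>i. v (g i b)))" for v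
    unfolding diagonalizes_quad_form[OF Vy] W_def
    by (subst sum.swap) (simp add: sum_J w g1 inner_emb)
  have le: "quad_form J X v \<le> ?d * (\<Sum>j\<in>J. ?z j * (cmod (inner_on J (\<lambda>i. W i j) v))\<^sup>2)" for v
    unfolding qY quad_form_Y
  proof (rule order_trans[OF quad_form_pinching], intro mult_left_mono sum_mono)
    fix b :: 'b
    \<comment> \<open>A diagonal block of \<open>X\<close> is at most the sum of all diagonal
      blocks, which is \<open>Y\<close>.\<close>
    show "quad_form J X (emb b (\<lambda>i. v (g i b))) \<le> (\<Sum>b'\<in>UNIV. quad_form J X (emb b' (\<lambda>i. v (g i b))))"
      using X by (intro member_le_sum) (auto simp: psd_on_iff)
  qed simp
  have "(\<Sum>j\<in>J. quad_form J X (\<lambda>i. W i j) * log 2 (?z j)) = (\<Sum>i\<in>I. quad_form I Y (\<lambda>l. V l i) * log 2 (y i))"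
    by (simp add: sum_J W_def w g1 quad_form_Y sum_distrib_right)
  also have "\<dots> = - vn_entropy I Y"
    unfolding S using diagonalizes_eigenvalue[OF fin Vy] by simp
  finally have C: "(\<Sum>j\<in>J. quad_form J X (\<lambda>i. W i j) * log 2 (?z j)) = - vn_entropy I Y" .
  have "(\<Sum>j\<in>J. ?z j) = ?d * tr I Y"
    unfolding T by (simp add: sum_J g1 sum_distrib_left)
  then have trz: "(\<Sum>j\<in>J. ?z j) = ?d * tr J X" by (simp add: trace_Y)
  note b = entropy_cross_bounds[OF fin_J X W z _ le, unfolded C trz]
  have t: "0 \<le> tr J X" using fin_J X by (rule tr_nonneg)
  have "log 2 ?d \<le> ?d / ln 2"
    using ln_le_minus_one[of ?d] d by (simp add: log_def divide_right_mono)
  then have "log 2 ?d * tr J X \<le> ?d / ln 2 * tr J X" using t by (rule mult_right_mono)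
  then have "vn_entropy I Y - ?d / ln 2 * tr J X \<le> vn_entropy J X"
    using b(1) d by simp
  moreover have "vn_entropy J X \<le> vn_entropy I Y + (?d * tr J X - tr J X) / ln 2"
    using b(2)[of 1] d by simp
  then have "vn_entropy J X \<le> vn_entropy I Y + ?d / ln 2 * tr J X"
    using t by (simp add: diff_divide_distrib) (smt (verit) divide_nonneg_nonneg ln_ge_zero)
  ultimately show ?thesis by linarith
qed

end

section \<open>Perturbation of the conditional mutual information\<close>

text \<open>\<open>op_fun\<close> chooses by \<open>SOME\<close>, so agreement on \<open>I\<close>
  is first turned into equality of the predicates \<open>diagonalizes\<close>, which forces the same
  choice.\<close>

lemma vn_entropy_cong:
  assumes "\<And>i j. i \<in> I \<Longrightarrow> j \<in> I \<Longrightarrow> M i j = M' i j"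
  shows "vn_entropy I M = vn_entropy I M'"
proof -
  have "diagonalizes I M = diagonalizes I M'"
    unfolding diagonalizes_def using assms by (intro ext) auto
  then have "op_fun I (log 2) M = op_fun I (log 2) M'" by (simp add: op_fun_def)
  then show ?thesis using assms by (simp add: vn_entropy_def op_trace_def op_mult_def)
qed

abbreviation sys :: "nat \<Rightarrow> ('a \<times> nat) set"
  where "sys n \<equiv> UNIV \<times> {..<n}"

lemma cond_mutual_info_cong:
  fixes X X' :: "(('a::finite \<times> 'b::finite) \<times> nat) opm"
  assumes eq: "\<And>i j. i \<in> sys n \<Longrightarrow> j \<in> sys n \<Longrightarrow> X i j = X' i j"
  shows "cond_mutual_info n X = cond_mutual_info n X'"
proof -
  have e: "X (x, e) (y, f) = X' (x, e) (y, f)" if "e < n" "f < n" for x y e f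
    using that by (intro eq) auto
  have "vn_entropy (sys n) (red_AE X) = vn_entropy (sys n) (red_AE X')"
    by (rule vn_entropy_cong) (auto simp: red_AE_def e)
  moreover have "vn_entropy (sys n) (red_BE X) = vn_entropy (sys n) (red_BE X')"
    by (rule vn_entropy_cong) (auto simp: red_BE_def e)
  moreover have "vn_entropy {..<n} (red_E X) = vn_entropy {..<n} (red_E X')"
    by (rule vn_entropy_cong) (auto simp: red_E_def e)
  moreover have "vn_entropy (sys n) X = vn_entropy (sys n) X'"
    using eq by (rule vn_entropy_cong)
  ultimately show ?thesis by (simp add: cond_mutual_info_def)
qed

lemma partial_trace_AE:
  fixes X :: "(('a::finite \<times> 'b::finite) \<times> nat) opm"
  assumes "psd_on (sys n) X"
  shows "psd_on (sys n) (red_AE X)" "op_trace (sys n) (red_AE X) = op_trace (sys n) X"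
    "\<bar>vn_entropy (sys n) X - vn_entropy (sys n) (red_AE X)\<bar> \<le> real CARD('b) / ln 2 * tr (sys n) X"
proof -
  interpret partial_trace "UNIV \<times> {..<n}" "UNIV \<times> {..<n}"
    "\<lambda>(a, e) b. ((a, b), e)" "\<lambda>((a, b), e). (a, e)" "\<lambda>((a, b), e). b" X
    using assms by unfold_locales (auto simp: image_iff)
  have "Y = red_AE X" by (auto simp: Y_def red_AE_def fun_eq_iff)
  then show "psd_on (sys n) (red_AE X)" "op_trace (sys n) (red_AE X) = op_trace (sys n) X"
    "\<bar>vn_entropy (sys n) X - vn_entropy (sys n) (red_AE X)\<bar> \<le> real CARD('b) / ln 2 * tr (sys n) X"
    using psd_Y trace_Y entropy_partial_trace by auto
qed

lemma partial_trace_BE: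
  fixes X :: "(('a::finite \<times> 'b::finite) \<times> nat) opm"
  assumes "psd_on (sys n) X"
  shows "psd_on (sys n) (red_BE X)" "op_trace (sys n) (red_BE X) = op_trace (sys n) X"
proof -
  interpret partial_trace "UNIV \<times> {..<n}" "UNIV \<times> {..<n}"
    "\<lambda>(b, e) a. ((a, b), e)" "\<lambda>((a, b), e). (b, e)" "\<lambda>((a, b), e). a" X
    using assms by unfold_locales (auto simp: image_iff)
  have "Y = red_BE X" by (auto simp: Y_def red_BE_def fun_eq_iff)
  then show "psd_on (sys n) (red_BE X)" "op_trace (sys n) (red_BE X) = op_trace (sys n) X"
    using psd_Y trace_Y by auto
qed

lemma partial_trace_E:
  fixes X :: "(('a::finite \<times> 'b::finite) \<times> nat) opm"
  assumes "psd_on (sys n) X"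
  shows "psd_on {..<n} (red_E X)" "op_trace {..<n} (red_E X) = op_trace (sys n) X"
    "\<bar>vn_entropy (sys n) (red_BE X) - vn_entropy {..<n} (red_E X)\<bar> \<le> real CARD('b) / ln 2 * tr (sys n) X"
proof -
  note BE = partial_trace_BE[OF assms]
  interpret partial_trace "{..<n}" "UNIV \<times> {..<n}" "\<lambda>e b. (b, e)" snd fst "red_BE X"
    using BE by unfold_locales (auto simp: image_iff)
  have "Y e e' = red_E X e e'" for e e'
  proof -
    have "Y e e' = (\<Sum>b\<in>UNIV. \<Sum>a\<in>UNIV. X ((a, b), e) ((a, b), e'))"
      unfolding Y_def by (simp add: red_BE_def)
    also have "\<dots> = (\<Sum>a\<in>UNIV. \<Sum>b\<in>UNIV. X ((a, b), e) ((a, b), e'))"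
      by (rule sum.swap)
    also have "\<dots> = red_E X e e'"
      unfolding red_E_def UNIV_Times_UNIV[symmetric] sum.cartesian_product
      by (intro sum.cong refl) auto
    finally show ?thesis .
  qed
  then have "Y = red_E X" by (intro ext)
  then show "psd_on {..<n} (red_E X)" "op_trace {..<n} (red_E X) = op_trace (sys n) X"
    "\<bar>vn_entropy (sys n) (red_BE X) - vn_entropy {..<n} (red_E X)\<bar> \<le> real CARD('b) / ln 2 * tr (sys n) X"
    using psd_Y trace_Y entropy_partial_trace BE(2) by auto
qed

text \<open>I(A;B|E) = (S(AE) - S(ABE)) + (S(BE) - S(E)), and in both differences only
  \<open>B\<close> is traced out. Hence neither \<open>A\<close> nor \<open>E\<close> enters the
  bound.\<close>

lemma cond_mutual_info_bound:
  fixes X :: "(('a::finite \<times> 'b::finite) \<times> nat) opm"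
  assumes "psd_on (sys n) X"
  shows "\<bar>cond_mutual_info n X\<bar> \<le> 2 * (real CARD('b) / ln 2 * tr (sys n) X)"
  using partial_trace_AE(3)[OF assms] partial_trace_E(3)[OF assms]
  unfolding cond_mutual_info_def by linarith

definition cmi_err :: "real \<Rightarrow> real \<Rightarrow> real"
  where "cmi_err d m = 2 * (d / ln 2 * m) + 4 * entropy_err m"

lemma cmi_err_tendsto: "(cmi_err d \<longlongrightarrow> 0) (at_right 0)"
proof -
  have "((\<lambda>m. 2 * (d / ln 2 * m) + 4 * entropy_err m) \<longlongrightarrow> 2 * (d / ln 2 * 0) + 4 * 0) (at_right 0)"
    by (intro tendsto_intros entropy_err_tendsto)
  then show ?thesis by (simp add: cmi_err_def[abs_def])
qed

text \<open>Near-additivity for each of the four entropies compares I of the sum with I of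
  \<open>X\<close> plus I of \<open>Y\<close>; the last is small because it is bounded by the trace
  of \<open>Y\<close>. These are the two summands of \<open>cmi_err\<close>.\<close>

lemma cond_mutual_info_perturb:
  fixes X Y :: "(('a::finite \<times> 'b::finite) \<times> nat) opm"
  assumes X: "psd_on (sys n) X" and Y: "psd_on (sys n) Y"
    and m: "tr (sys n) Y \<le> m" "0 < m" "m \<le> 1" and t: "tr (sys n) X + tr (sys n) Y \<le> 3"
  shows "\<bar>cond_mutual_info n (\<lambda>i j. X i j + Y i j) - cond_mutual_info n X\<bar> \<le> cmi_err (real CARD('b)) m"
proof -
  let ?Z = "\<lambda>i j. X i j + Y i j"
  have AE: "red_AE ?Z = (\<lambda>i j. red_AE X i j + red_AE Y i j)"
    by (auto simp: red_AE_def fun_eq_iff sum.distrib)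
  have BE: "red_BE ?Z = (\<lambda>i j. red_BE X i j + red_BE Y i j)"
    by (auto simp: red_BE_def fun_eq_iff sum.distrib)
  have E: "red_E ?Z = (\<lambda>i j. red_E X i j + red_E Y i j)"
    by (auto simp: red_E_def fun_eq_iff sum.distrib)
  have "\<bar>vn_entropy (sys n) ?Z - vn_entropy (sys n) X - vn_entropy (sys n) Y\<bar> \<le> entropy_err m"
    by (rule entropy_almost_additive) (use assms in auto)
  moreover have "\<bar>vn_entropy (sys n) (red_AE ?Z) - vn_entropy (sys n) (red_AE X) - vn_entropy (sys n) (red_AE Y)\<bar> \<le> entropy_err m"
    unfolding AE by (rule entropy_almost_additive)
      (use assms partial_trace_AE[OF X] partial_trace_AE[OF Y] in auto)
  moreover have "\<bar>vn_entropy (sys n) (red_BE ?Z) - vn_entropy (sys n) (red_BE X) - vn_entropy (sys n) (red_BE Y)\<bar> \<le> entropy_err m"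
    unfolding BE by (rule entropy_almost_additive)
      (use assms partial_trace_BE[OF X] partial_trace_BE[OF Y] in auto)
  moreover have "\<bar>vn_entropy {..<n} (red_E ?Z) - vn_entropy {..<n} (red_E X) - vn_entropy {..<n} (red_E Y)\<bar> \<le> entropy_err m"
    unfolding E by (rule entropy_almost_additive)
      (use assms partial_trace_E[OF X] partial_trace_E[OF Y] in auto)
  moreover have "\<bar>cond_mutual_info n Y\<bar> \<le> 2 * (real CARD('b) / ln 2 * m)"
  proof (rule order_trans[OF cond_mutual_info_bound[OF Y]])
    show "2 * (real CARD('b) / ln 2 * tr (sys n) Y) \<le> 2 * (real CARD('b) / ln 2 * m)"
      using m by (intro mult_left_mono) auto
  qed
  ultimately show ?thesis
    unfolding cmi_err_def cond_mutual_info_def by linarith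
qed

section \<open>Conjugation by an operator on \<open>AB\<close>\<close>

definition sandwich :: "'i set \<Rightarrow> 'i opm \<Rightarrow> 'i opm \<Rightarrow> 'i opm"
  where "sandwich I K X = (\<lambda>i j. \<Sum>k\<in>I. \<Sum>l\<in>I. K i k * X k l * cnj (K j l))"

lemma psd_sandwich:
  assumes X: "psd_on I X"
  shows "psd_on I (sandwich I K X)"
proof -
  have H: "X k l = cnj (X l k)" if "k \<in> I" "l \<in> I" for k l
    using X that unfolding psd_on_def hermitian_on_def by blast
  have "sandwich I K X i j = cnj (sandwich I K X j i)" for i j
  proof -
    have "cnj (sandwich I K X j i) = (\<Sum>k\<in>I. \<Sum>l\<in>I. K i l * cnj (X k l) * cnj (K j k))"
      by (simp add: sandwich_def mult_ac)
    also have "\<dots> = (\<Sum>l\<in>I. \<Sum>k\<in>I. K i l * X l k * cnj (K j k))"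
      by (subst sum.swap) (intro sum.cong refl arg_cong2[where f="(*)"] H[symmetric])
    finally show ?thesis by (simp add: sandwich_def)
  qed
  moreover have "0 \<le> quad_form I (sandwich I K X) v" for v
  proof -
    define w where "w k = (\<Sum>i\<in>I. cnj (K i k) * v i)" for k
    have "(\<Sum>i\<in>I. \<Sum>j\<in>I. cnj (v i) * sandwich I K X i j * v j)
        = (\<Sum>i\<in>I. \<Sum>j\<in>I. \<Sum>k\<in>I. \<Sum>l\<in>I. (cnj (v i) * K i k) * X k l * (cnj (K j l) * v j))"
      by (simp add: sandwich_def sum_distrib_left sum_distrib_right mult_ac)
    also have "\<dots> = (\<Sum>k\<in>I. \<Sum>l\<in>I. \<Sum>i\<in>I. \<Sum>j\<in>I. (cnj (v i) * K i k) * X k l * (cnj (K j l) * v j))"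
      unfolding sum.cartesian_product
      by (rule sum.reindex_bij_witness[of _ "\<lambda>(k, l, i, j). (i, j, k, l)" "\<lambda>(i, j, k, l). (k, l, i, j)"])
        auto
    also have "\<dots> = (\<Sum>k\<in>I. \<Sum>l\<in>I. cnj (w k) * X k l * w l)"
      by (simp add: w_def sum_distrib_left sum_distrib_right mult_ac)
    finally have "quad_form I (sandwich I K X) v = quad_form I X w"
      by (simp add: quad_form_sum)
    then show ?thesis using X by (simp add: psd_on_iff)
  qed
  ultimately show ?thesis unfolding psd_on_iff hermitian_on_def by blast
qed

abbreviation delta :: "'i \<Rightarrow> 'i \<Rightarrow> complex"
  where "delta i j \<equiv> (if i = j then 1 else 0)"

text \<open>The cross terms \<open>L X\<close> and \<open>X L*\<close> cancel, so a conjugation close to the identity is compared with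
  the identity by adding small positive operators on both sides.\<close>

lemma sandwich_split:
  fixes t :: real
  assumes "finite I" "0 < t" "i \<in> I" "j \<in> I"
  shows "sandwich I (\<lambda>i j. delta i j + L i j) X i j
      + sandwich I (\<lambda>i j. of_real (sqrt t) * delta i j - of_real (1 / sqrt t) * L i j) X i j
    = X i j + (of_real t * X i j + of_real (1 + 1 / t) * sandwich I L X i j)"
proof -
  \<comment> \<open>The weights \<open>s\<close> and \<open>1 / s\<close> have product 1, so the
    cross terms of the second conjugation are the negatives of those of the first for every
    \<open>t\<close>. Only the square terms, with weights \<open>t\<close> and \<open>1 / t\<close>,
    keep the parameter.\<close>
  define s where "s = complex_of_real (sqrt t)"
  have s: "s \<noteq> 0" "s * s = of_real t" "cnj s = s" using assms
    by (auto simp: s_def simp flip: of_real_mult)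
  have eq: "(delta i k + L i k) * X k l * cnj (delta j l + L j l)
      + (s * delta i k - 1 / s * L i k) * X k l * cnj (s * delta j l - 1 / s * L j l)
    = (1 + of_real t) * (delta i k * X k l * delta j l) + (1 + 1 / of_real t) * (L i k * X k l * cnj (L j l))" for k l
    unfolding s(2)[symmetric] using s(1,3) by (simp add: field_simps)
  have "X i j = (\<Sum>k\<in>I. delta i k * (\<Sum>l\<in>I. X k l * delta j l))"
    using assms by (simp add: if_distrib[of "\<lambda>x. _ * x"] if_distrib[of "\<lambda>x. x * _"] cong: if_cong)
  then have D: "(\<Sum>k\<in>I. \<Sum>l\<in>I. delta i k * X k l * delta j l) = X i j"
    by (simp add: sum_distrib_left mult.assoc)
  have "sandwich I (\<lambda>i j. delta i j + L i j) X i j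
      + sandwich I (\<lambda>i j. s * delta i j - 1 / s * L i j) X i j
    = (\<Sum>k\<in>I. \<Sum>l\<in>I. (1 + of_real t) * (delta i k * X k l * delta j l)
        + (1 + 1 / of_real t) * (L i k * X k l * cnj (L j l)))"
    unfolding sandwich_def sum.distrib[symmetric] eq ..
  also have "\<dots> = (1 + of_real t) * X i j + (1 + 1 / of_real t) * sandwich I L X i j"
    unfolding sum.distrib sum_distrib_left[symmetric] D sandwich_def ..
  finally show ?thesis by (simp add: s_def algebra_simps)
qed

definition lift_op :: "'x opm \<Rightarrow> ('x \<times> nat) opm"
  where "lift_op K = (\<lambda>(x, e) (y, f). if e = f then K x y else 0)"

text \<open>Moves the traces of conjugated extensions to \<open>AB\<close>, where they depend on the
  reduced state alone.\<close>

lemma red_AB_sandwich: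
  fixes X :: "(('a::finite \<times> 'b::finite) \<times> nat) opm"
  shows "red_AB n (sandwich (sys n) (lift_op K) X) = sandwich UNIV K (red_AB n X)"
proof (intro ext)
  fix x y
  have S: "(\<Sum>k\<in>sys n. f k) = (\<Sum>x\<in>UNIV. \<Sum>e<n. f (x, e))" for f :: "('a \<times> 'b) \<times> nat \<Rightarrow> complex"
    by (simp add: sum.cartesian_product case_prod_unfold)
  have "sandwich (sys n) (lift_op K) X (x, e) (y, e)
      = (\<Sum>k\<in>UNIV. \<Sum>l\<in>UNIV. K x k * X (k, e) (l, e) * cnj (K y l))" if "e < n" for e
  proof -
    have "sandwich (sys n) (lift_op K) X (x, e) (y, e) = (\<Sum>k\<in>UNIV. \<Sum>f<n. if e = f then
        (\<Sum>l\<in>UNIV. \<Sum>h<n. if e = h then K x k * X (k, f) (l, h) * cnj (K y l) else 0) else 0)"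
      unfolding sandwich_def S
      by (intro sum.cong refl)
        (auto simp: lift_op_def if_distrib[of cnj] if_distrib[of "\<lambda>x. _ * x"] cong: if_cong)
    then show ?thesis using that by simp
  qed
  then have "red_AB n (sandwich (sys n) (lift_op K) X) x y
      = (\<Sum>e<n. \<Sum>k\<in>UNIV. \<Sum>l\<in>UNIV. K x k * X (k, e) (l, e) * cnj (K y l))"
    by (simp add: red_AB_def)
  also have "\<dots> = (\<Sum>k\<in>UNIV. \<Sum>e<n. \<Sum>l\<in>UNIV. K x k * X (k, e) (l, e) * cnj (K y l))"
    by (rule sum.swap)
  also have "\<dots> = (\<Sum>k\<in>UNIV. \<Sum>l\<in>UNIV. \<Sum>e<n. K x k * X (k, e) (l, e) * cnj (K y l))"
    by (rule sum.cong[OF refl], rule sum.swap)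
  also have "\<dots> = sandwich UNIV K (red_AB n X) x y"
    by (simp add: sandwich_def red_AB_def sum_distrib_left sum_distrib_right)
  finally show "red_AB n (sandwich (sys n) (lift_op K) X) x y = sandwich UNIV K (red_AB n X) x y" .
qed

lemma op_trace_red_AB: "op_trace (sys n) X = op_trace UNIV (red_AB n X)"
  by (simp add: op_trace_def red_AB_def sum.cartesian_product case_prod_unfold)

text \<open>\<open>KX + JX\<close> and \<open>X + LX\<close> are the same operator, so
  \<open>KX\<close> and \<open>X\<close> are each one small positive increment away from it. The
  increment \<open>LX\<close> has trace at most \<open>t + (1 + 1 / t) * t\<^sup>2\<close>, that is
  \<open>2 * t + t\<^sup>2\<close>, and \<open>t \<le> 1 / 3\<close> keeps this below 1.\<close>

lemma cond_mutual_info_sandwich: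
  fixes X :: "(('a::finite \<times> 'b::finite) \<times> nat) opm"
  assumes X: "psd_on (sys n) X" and X1: "tr (sys n) X = 1" and t: "0 < t" "t \<le> 1 / 3"
    and L: "tr UNIV (sandwich UNIV L (red_AB n X)) \<le> t\<^sup>2"
    and K1: "tr UNIV (sandwich UNIV (\<lambda>x y. delta x y + L x y) (red_AB n X)) = 1"
  shows "\<bar>cond_mutual_info n (sandwich (sys n) (lift_op (\<lambda>x y. delta x y + L x y)) X) - cond_mutual_info n X\<bar>
    \<le> 2 * cmi_err (real CARD('b)) (2 * t + t\<^sup>2)"
proof -
  let ?K = "lift_op (\<lambda>x y. delta x y + L x y)" and ?L = "lift_op L"
  define KX where "KX = sandwich (sys n) ?K X"
  define JX where "JX = sandwich (sys n) (\<lambda>i j. of_real (sqrt t) * delta i j - of_real (1 / sqrt t) * ?L i j) X"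
  define LX where "LX = (\<lambda>i j. of_real t * X i j + of_real (1 + 1 / t) * sandwich (sys n) ?L X i j)"
  have K: "?K = (\<lambda>i j. delta i j + ?L i j)"
    by (auto simp: lift_op_def fun_eq_iff)
  have split: "KX i j + JX i j = X i j + LX i j" if "i \<in> sys n" "j \<in> sys n" for i j
    unfolding KX_def JX_def LX_def K by (rule sandwich_split) (use that t in auto)
  have pK: "psd_on (sys n) KX" and pJ: "psd_on (sys n) JX"
    unfolding KX_def JX_def using X by (auto intro: psd_sandwich)
  have pL: "psd_on (sys n) LX"
    unfolding LX_def using X t by (intro psd_on_add psd_on_scale psd_sandwich) auto
  have trK: "tr (sys n) KX = 1"
    unfolding KX_def op_trace_red_AB red_AB_sandwich using K1 by simp
  have "tr (sys n) (sandwich (sys n) ?L X) \<le> t\<^sup>2"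
    unfolding op_trace_red_AB red_AB_sandwich using L by simp
  then have "(1 + 1 / t) * tr (sys n) (sandwich (sys n) ?L X) \<le> (1 + 1 / t) * t\<^sup>2"
    using t by (intro mult_left_mono) auto
  also have "\<dots> = t\<^sup>2 + t" using t by (simp add: field_simps power2_eq_square)
  finally have trL: "tr (sys n) LX \<le> 2 * t + t\<^sup>2"
    unfolding LX_def op_trace_add op_trace_scale using X1 by simp
  \<comment> \<open>Trace balance: \<open>KX\<close> and \<open>X\<close> both have trace 1, so
    \<open>JX\<close> has the same trace as \<open>LX\<close> and needs no estimate of its
    own.\<close>
  have "op_trace (sys n) (\<lambda>i j. KX i j + JX i j) = op_trace (sys n) (\<lambda>i j. X i j + LX i j)"
    unfolding op_trace_def using split by (intro sum.cong) auto
  then have "tr (sys n) KX + tr (sys n) JX = tr (sys n) X + tr (sys n) LX"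
    unfolding op_trace_add by (metis plus_complex.simps(1))
  then have trJ: "tr (sys n) JX \<le> 2 * t + t\<^sup>2" using trL trK X1 by simp
  have "t\<^sup>2 \<le> (1 / 3)\<^sup>2" using t by (intro power_mono) auto
  then have m: "2 * t + t\<^sup>2 \<le> 1" "0 < 2 * t + t\<^sup>2" using t by (auto simp: power2_eq_square add_pos_nonneg)
  have "cond_mutual_info n (\<lambda>i j. KX i j + JX i j) = cond_mutual_info n (\<lambda>i j. X i j + LX i j)"
    using split by (rule cond_mutual_info_cong)
  moreover have "\<bar>cond_mutual_info n (\<lambda>i j. KX i j + JX i j) - cond_mutual_info n KX\<bar> \<le> cmi_err (real CARD('b)) (2 * t + t\<^sup>2)"
    using pK pJ trJ m trK by (intro cond_mutual_info_perturb) auto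
  moreover have "\<bar>cond_mutual_info n (\<lambda>i j. X i j + LX i j) - cond_mutual_info n X\<bar> \<le> cmi_err (real CARD('b)) (2 * t + t\<^sup>2)"
    using X pL trL m X1 by (intro cond_mutual_info_perturb) auto
  ultimately show ?thesis unfolding KX_def by linarith
qed

section \<open>Square roots and the trace norm\<close>

lemma op_mult_assoc: "op_mult I (op_mult I A B) C = op_mult I A (op_mult I B C)"
proof (intro ext)
  fix i j
  have "op_mult I (op_mult I A B) C i j = (\<Sum>k\<in>I. \<Sum>l\<in>I. A i l * B l k * C k j)"
    by (simp add: op_mult_def sum_distrib_right)
  also have "\<dots> = op_mult I A (op_mult I B C) i j"
    by (subst sum.swap) (simp add: op_mult_def sum_distrib_left mult.assoc)
  finally show "op_mult I (op_mult I A B) C i j = op_mult I A (op_mult I B C) i j" .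
qed

lemma mat_vec_op_mult: "mat_vec I (op_mult I A B) v = mat_vec I A (mat_vec I B v)"
proof (intro ext)
  fix i
  have "mat_vec I (op_mult I A B) v i = (\<Sum>k\<in>I. \<Sum>l\<in>I. A i l * B l k * v k)"
    by (simp add: mat_vec_def op_mult_def sum_distrib_right)
  also have "\<dots> = mat_vec I A (mat_vec I B v) i"
    by (subst sum.swap) (simp add: mat_vec_def sum_distrib_left mult.assoc)
  finally show "mat_vec I (op_mult I A B) v i = mat_vec I A (mat_vec I B v) i" .
qed

lemma op_mult_delta_left: "op_mult (UNIV::'n::finite set) delta M = M"
  by (simp add: op_mult_def if_distrib[of "\<lambda>x. x * _"] cong: if_cong)

lemma op_mult_delta_right: "op_mult (UNIV::'n::finite set) M delta = M"
  by (simp add: op_mult_def if_distrib[of "\<lambda>x. _ * x"] cong: if_cong)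

lemma psd_conj_diag:
  assumes "\<And>k. k \<in> I \<Longrightarrow> 0 \<le> d k"
  shows "psd_on I (conj_diag I U d)"
  unfolding psd_on_iff
proof (intro conjI allI)
  show "hermitian_on I (conj_diag I U d)"
    by (simp add: hermitian_on_def conj_diag_def mult_ac)
  show "0 \<le> quad_form I (conj_diag I U d) v" for v
    unfolding quad_form_def conj_diag_inner[of I _ U d, OF refl] Re_complex_of_real
    using assms by (intro sum_nonneg) auto
qed

text \<open>The inverse of the root is conditional because the lemma serves both the mixed state,
  which is strictly positive, and a target state that may be singular.\<close>

lemma psd_square_root:
  fixes M :: "'n::finite opm"
  assumes "psd_on UNIV M"
  obtains R where "psd_on UNIV R" "op_mult UNIV R R = M"
    "(\<exists>c>0. \<forall>v. c * norm2_on UNIV v \<le> quad_form UNIV M v) \<Longrightarrow> \<exists>Q. op_mult UNIV Q R = delta"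
proof -
  obtain U d where Ud: "diagonalizes UNIV M U d" and d: "\<And>k. 0 \<le> d k"
    using entropy_diagonalization[OF finite_class.finite_UNIV assms] by (metis UNIV_I)
  have U: "unitary_on UNIV U" and M: "M = conj_diag UNIV U d"
    using Ud by (auto simp: diagonalizes_def fun_eq_iff)
  define R where "R = conj_diag UNIV U (\<lambda>k. sqrt (d k))"
  have "psd_on UNIV R" unfolding R_def using d by (intro psd_conj_diag) simp
  moreover have "op_mult UNIV R R = M"
    unfolding R_def M conj_diag_mult[OF finite_class.finite_UNIV U] using d by simp
  moreover have "\<exists>Q. op_mult UNIV Q R = delta"
    if pos: "\<exists>c>0. \<forall>v. c * norm2_on UNIV v \<le> quad_form UNIV M v"
  proof -
    obtain c where c: "c > 0" "\<And>v. c * norm2_on UNIV v \<le> quad_form UNIV M v" using pos by blast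
    have "d k > 0" for k
      using c(2)[of "\<lambda>i. U i k"] c(1) diagonalizes_eigenvalue[OF finite_class.finite_UNIV Ud, of k]
        orthonormal_on_norm2[OF unitary_on_orthonormal[OF U], of k] by simp
    then have "(\<lambda>k. 1 / sqrt (d k) * sqrt (d k)) = (\<lambda>k. 1)"
      by (metis less_numeral_extra(3) nonzero_divide_eq_eq real_sqrt_eq_0_iff)
    then have "op_mult UNIV (conj_diag UNIV U (\<lambda>k. 1 / sqrt (d k))) R = conj_diag UNIV U (\<lambda>k. 1)"
      unfolding R_def conj_diag_mult[OF finite_class.finite_UNIV U] by simp
    also have "\<dots> = delta"
      using U unfolding unitary_on_def op_mult_def op_adj_def conj_diag_def by (intro ext) simp
    finally show ?thesis by blast
  qed
  ultimately show ?thesis using that by blast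
qed

lemma diagonalizes_eigenvector:
  assumes "finite I" "diagonalizes I M U d" "k \<in> I" "i \<in> I"
  shows "mat_vec I M (col U k) i = of_real (d k) * U i k"
proof -
  have o: "orthonormal_on I I (col U)" and M: "\<And>j. j \<in> I \<Longrightarrow> M i j = conj_diag I U d i j"
    using assms unitary_on_orthonormal unfolding diagonalizes_def by blast+
  have "mat_vec I M (col U k) i = (\<Sum>j\<in>I. \<Sum>l\<in>I. U i l * of_real (d l) * (cnj (U j l) * U j k))"
    unfolding mat_vec_def using M by (simp add: conj_diag_def sum_distrib_right mult.assoc)
  also have "\<dots> = (\<Sum>l\<in>I. U i l * of_real (d l) * inner_on I (col U l) (col U k))"
    by (subst sum.swap) (simp add: inner_on_def sum_distrib_left)
  also have "\<dots> = (\<Sum>l\<in>I. if l = k then of_real (d k) * U i k else 0)"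
    using o assms(3) unfolding orthonormal_on_def by (intro sum.cong refl) simp
  finally show ?thesis using assms by simp
qed

lemma hermitian_on_square_trace:
  assumes "finite I" "diagonalizes I M U d" "hermitian_on I M"
  shows "(\<Sum>i\<in>I. \<Sum>j\<in>I. (cmod (M i j))\<^sup>2) = (\<Sum>k\<in>I. (d k)\<^sup>2)"
proof -
  have U: "unitary_on I U" and M: "\<And>i j. i \<in> I \<Longrightarrow> j \<in> I \<Longrightarrow> M i j = conj_diag I U d i j"
    using assms by (auto simp: diagonalizes_def)
  have "op_trace I (op_mult I M M) = of_real (\<Sum>k\<in>I. d k * d k)"
  proof (rule diagonalizes_trace[OF assms(1) U])
    fix i assume "i \<in> I"
    then show "op_mult I M M i i = conj_diag I U (\<lambda>k. d k * d k) i i"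
      unfolding conj_diag_mult[OF assms(1) U, symmetric] using M by (intro op_mult_cong) auto
  qed
  moreover have "op_trace I (op_mult I M M) = of_real (\<Sum>i\<in>I. \<Sum>j\<in>I. (cmod (M i j))\<^sup>2)"
    unfolding op_trace_def op_mult_def of_real_sum
  proof (intro sum.cong refl)
    fix i j assume "i \<in> I" "j \<in> I"
    then have "M j i = cnj (M i j)" using assms(3) unfolding hermitian_on_def by blast
    then show "M i j * M j i = complex_of_real ((cmod (M i j))\<^sup>2)"
      by (simp add: complex_norm_square del: of_real_power)
  qed
  ultimately show ?thesis by (simp only: of_real_eq_iff power2_eq_square)
qed

lemma quad_form_le_entries:
  assumes "finite I"
  shows "\<bar>quad_form I M v\<bar> \<le> norm2_on I v * (\<Sum>i\<in>I. \<Sum>j\<in>I. cmod (M i j))"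
proof -
  have v: "cmod (v i) * cmod (v j) \<le> norm2_on I v" if "i \<in> I" "j \<in> I" for i j
  proof -
    have "(cmod (v k))\<^sup>2 \<le> norm2_on I v" if "k \<in> I" for k
      unfolding norm2_on_def by (rule member_le_sum) (use that assms in auto)
    with that have "(cmod (v i))\<^sup>2 \<le> norm2_on I v" "(cmod (v j))\<^sup>2 \<le> norm2_on I v" by auto
    then show ?thesis using sum_squares_bound[of "cmod (v i)" "cmod (v j)"] by linarith
  qed
  have "\<bar>quad_form I M v\<bar> \<le> cmod (\<Sum>i\<in>I. \<Sum>j\<in>I. cnj (v i) * M i j * v j)"
    unfolding quad_form_sum by (rule abs_Re_le_cmod)
  also have "\<dots> \<le> (\<Sum>i\<in>I. \<Sum>j\<in>I. cmod (cnj (v i) * M i j * v j))"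
    by (intro order_trans[OF norm_sum] sum_mono) simp
  also have "\<dots> = (\<Sum>i\<in>I. \<Sum>j\<in>I. cmod (v i) * cmod (v j) * cmod (M i j))"
    by (simp add: norm_mult mult_ac)
  also have "\<dots> \<le> (\<Sum>i\<in>I. \<Sum>j\<in>I. norm2_on I v * cmod (M i j))"
    using v by (intro sum_mono mult_right_mono) auto
  finally show ?thesis by (simp add: sum_distrib_left)
qed

text \<open>The Powers--Stoermer argument: in the eigenbasis of \<open>A - B\<close> the diagonal entries of \<open>A\<^sup>2 - B\<^sup>2\<close>
  dominate the squared eigenvalues.\<close>

lemma square_root_continuity:
  fixes A B :: "'n::finite opm"
  assumes A: "psd_on UNIV A" and B: "psd_on UNIV B"
  shows "(\<Sum>i\<in>UNIV. \<Sum>j\<in>UNIV. (cmod (A i j - B i j))\<^sup>2)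
    \<le> real CARD('n) * (\<Sum>i\<in>UNIV. \<Sum>j\<in>UNIV. cmod (op_mult UNIV A A i j - op_mult UNIV B B i j))"
proof -
  let ?I = "UNIV :: 'n set"
  let ?X = "\<lambda>i j. A i j + of_real (- 1) * B i j"
  let ?M = "\<lambda>i j. op_mult ?I A A i j + of_real (- 1) * op_mult ?I B B i j"
  have hA: "hermitian_on ?I A" and hB: "hermitian_on ?I B" using A B by (auto simp: psd_on_iff)
  have hX: "hermitian_on ?I ?X"
    by (intro hermitian_on_add hermitian_on_scale hA hB)
  obtain U x where Ux: "diagonalizes ?I ?X U x" using spectral_theorem_on[OF finite_class.finite_UNIV hX] by blast
  have norm: "norm2_on ?I (col U k) = 1" for k
    using Ux unitary_on_orthonormal orthonormal_on_norm2 unfolding diagonalizes_def by (metis UNIV_I)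
  have "(x k)\<^sup>2 \<le> \<bar>quad_form ?I ?M (col U k)\<bar>" for k
  proof -
    let ?u = "col U k"
    define a b where "a = quad_form ?I A ?u" and "b = quad_form ?I B ?u"
    have "quad_form ?I ?X ?u = a - b"
      unfolding quad_form_add quad_form_scale a_def b_def by simp
    then have x: "x k = a - b" using diagonalizes_eigenvalue[OF finite_class.finite_UNIV Ux, of k] by simp
    have ab: "0 \<le> a" "0 \<le> b" unfolding a_def b_def using A B by (auto simp: psd_on_iff)
    have "mat_vec ?I ?X ?u = (\<lambda>i. mat_vec ?I A ?u i - mat_vec ?I B ?u i)"
      by (simp add: mat_vec_def algebra_simps sum_subtractf)
    then have Au: "mat_vec ?I A ?u = (\<lambda>i. mat_vec ?I B ?u i + of_real (x k) * ?u i)"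
      using diagonalizes_eigenvector[OF finite_class.finite_UNIV Ux, of k] by (simp add: fun_eq_iff algebra_simps)
    have sq: "quad_form ?I (op_mult ?I C C) ?u = Re (inner_on ?I (mat_vec ?I C ?u) (mat_vec ?I C ?u))"
      if "hermitian_on ?I C" for C
      unfolding quad_form_def mat_vec_op_mult hermitian_on_inner[OF that] ..
    have "Re (inner_on ?I ?u (mat_vec ?I B ?u)) = b" "Re (inner_on ?I (mat_vec ?I B ?u) ?u) = b"
      unfolding hermitian_on_inner[OF hB, symmetric] by (simp_all add: b_def quad_form_def)
    \<comment> \<open>On the eigenvector \<open>A u = B u + x u\<close>, so the difference of the
      expectations of the two squares factors as \<open>(a - b) * (a + b)\<close>. Positivity gives
      \<open>\<bar>a - b\<bar> \<le> a + b\<close>.\<close>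
    then have "quad_form ?I (op_mult ?I A A) ?u = quad_form ?I (op_mult ?I B B) ?u + 2 * x k * b + (x k)\<^sup>2"
      unfolding sq[OF hA] sq[OF hB] Au
      by (simp add: inner_on_add_left inner_on_add_right inner_on_scale_left inner_on_scale_right
          inner_on_self norm power2_eq_square)
    then have "quad_form ?I ?M ?u = 2 * x k * b + (x k)\<^sup>2"
      unfolding quad_form_add quad_form_scale by simp
    also have "\<dots> = (a - b) * (a + b)" unfolding x by (simp add: power2_eq_square algebra_simps)
    finally have "\<bar>quad_form ?I ?M ?u\<bar> = \<bar>a - b\<bar> * (a + b)" using ab by (simp add: abs_mult)
    moreover have "\<bar>a - b\<bar> * \<bar>a - b\<bar> \<le> \<bar>a - b\<bar> * (a + b)" using ab by (intro mult_left_mono) auto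
    ultimately show ?thesis unfolding x by (simp add: power2_eq_square flip: abs_mult)
  qed
  \<comment> \<open>Each of the \<open>CARD('n)\<close> expectations is bounded by the full sum of
    entries, which is where the dimension factor arises.\<close>
  moreover have "\<bar>quad_form ?I ?M (col U k)\<bar> \<le> (\<Sum>i\<in>UNIV. \<Sum>j\<in>UNIV. cmod (?M i j))" for k
    using quad_form_le_entries[OF finite_class.finite_UNIV, of ?M "col U k"] by (simp add: norm)
  ultimately have "(\<Sum>k\<in>?I. (x k)\<^sup>2) \<le> (\<Sum>k\<in>?I. \<Sum>i\<in>UNIV. \<Sum>j\<in>UNIV. cmod (?M i j))"
    by (intro sum_mono) (rule order_trans)
  then have "(\<Sum>i\<in>?I. \<Sum>j\<in>?I. (cmod (?X i j))\<^sup>2) \<le> real CARD('n) * (\<Sum>i\<in>UNIV. \<Sum>j\<in>UNIV. cmod (?M i j))"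
    unfolding hermitian_on_square_trace[OF finite_class.finite_UNIV Ux hX] by simp
  then show ?thesis by simp
qed

text \<open>Conjugating R R by K gives K R times its adjoint, so the trace becomes the squared
  Hilbert-Schmidt norm of K R.\<close>

lemma sandwich_square:
  assumes "hermitian_on I R"
  shows "sandwich I K (op_mult I R R) = (\<lambda>i j. \<Sum>m\<in>I. op_mult I K R i m * cnj (op_mult I K R j m))"
proof (intro ext)
  fix i j
  have R: "R m l = cnj (R l m)" if "m \<in> I" "l \<in> I" for m l
    using assms that unfolding hermitian_on_def by blast
  have "sandwich I K (op_mult I R R) i j = (\<Sum>k\<in>I. \<Sum>l\<in>I. \<Sum>m\<in>I. (K i k * R k m) * (R m l * cnj (K j l)))"
    by (simp add: sandwich_def op_mult_def sum_distrib_left sum_distrib_right mult.assoc)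
  also have "\<dots> = (\<Sum>k\<in>I. \<Sum>m\<in>I. \<Sum>l\<in>I. (K i k * R k m) * (R m l * cnj (K j l)))"
    by (rule sum.cong[OF refl], rule sum.swap)
  also have "\<dots> = (\<Sum>m\<in>I. \<Sum>k\<in>I. \<Sum>l\<in>I. (K i k * R k m) * (R m l * cnj (K j l)))"
    by (rule sum.swap)
  also have "\<dots> = (\<Sum>m\<in>I. \<Sum>k\<in>I. \<Sum>l\<in>I. (K i k * R k m) * cnj (K j l * R l m))"
  proof (intro sum.cong refl)
    fix k l m assume "m \<in> I" "l \<in> I"
    from R[OF this] show "(K i k * R k m) * (R m l * cnj (K j l)) = (K i k * R k m) * cnj (K j l * R l m)"
      by (simp only: complex_cnj_mult mult.commute)
  qed
  finally show "sandwich I K (op_mult I R R) i j = (\<Sum>m\<in>I. op_mult I K R i m * cnj (op_mult I K R j m))"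
    by (simp add: op_mult_def sum_product)
qed

text \<open>An entry is at most the Hilbert-Schmidt norm, the l2 norm of the singular values
  \<open>sqrt (d k)\<close>, and this is at most their sum.\<close>

lemma entry_le_trace_norm:
  assumes I: "finite I" and ij: "i \<in> I" "j \<in> I"
  shows "cmod (M i j) \<le> trace_norm I M"
proof -
  let ?N = "op_mult I (op_adj M) M"
  have h: "hermitian_on I ?N"
    by (simp add: hermitian_on_def op_mult_def op_adj_def mult.commute)
  obtain U d where Ud: "diagonalizes I ?N U d" and f: "\<And>f. op_fun I f ?N = conj_diag I U (\<lambda>k. f (d k))"
    using op_fun_diagonalization[OF I h] by blast
  have U: "unitary_on I U" and N: "\<And>i j. i \<in> I \<Longrightarrow> j \<in> I \<Longrightarrow> ?N i j = conj_diag I U d i j"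
    using Ud by (auto simp: diagonalizes_def)
  have "0 \<le> quad_form I ?N v" for v
  proof -
    have "inner_on I v (mat_vec I (op_adj M) w) = inner_on I (mat_vec I M v) w" for w
      unfolding inner_on_def mat_vec_def op_adj_def
      by (simp add: sum_distrib_left sum_distrib_right mult_ac) (rule sum.swap)
    then show ?thesis unfolding quad_form_def mat_vec_op_mult by (simp add: inner_on_self norm2_on_nonneg)
  qed
  then have d: "0 \<le> d k" if "k \<in> I" for k using diagonalizes_eigenvalue[OF I Ud that] by metis
  have "trace_norm I M = (\<Sum>k\<in>I. sqrt (d k))"
    unfolding trace_norm_def f using diagonalizes_trace[OF I U, of _ "\<lambda>k. sqrt (d k)"] by simp
  moreover have "op_trace I ?N = of_real (\<Sum>k\<in>I. d k)" using N by (rule diagonalizes_trace[OF I U])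
  moreover have "op_trace I ?N = of_real (\<Sum>j\<in>I. \<Sum>i\<in>I. (cmod (M i j))\<^sup>2)"
    by (simp add: op_trace_def op_mult_def op_adj_def complex_norm_square mult.commute del: of_real_power)
  ultimately have tn: "trace_norm I M = (\<Sum>k\<in>I. sqrt (d k))"
    and sq: "(\<Sum>k\<in>I. d k) = (\<Sum>j\<in>I. \<Sum>i\<in>I. (cmod (M i j))\<^sup>2)" by (simp_all only: of_real_eq_iff)
  have s0: "0 \<le> (\<Sum>k\<in>I. sqrt (d k))" using d by (intro sum_nonneg) auto
  have "(cmod (M i j))\<^sup>2 \<le> (\<Sum>i\<in>I. (cmod (M i j))\<^sup>2)"
    using I ij by (intro member_le_sum) auto
  also have "\<dots> \<le> (\<Sum>j\<in>I. \<Sum>i\<in>I. (cmod (M i j))\<^sup>2)"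
    using I ij by (intro member_le_sum[where f="\<lambda>j. \<Sum>i\<in>I. (cmod (M i j))\<^sup>2"]) (auto intro: sum_nonneg)
  also have "\<dots> = (\<Sum>k\<in>I. sqrt (d k) * sqrt (d k))" unfolding sq[symmetric] using d by simp
  also have "\<dots> \<le> (\<Sum>k\<in>I. sqrt (d k) * (\<Sum>l\<in>I. sqrt (d l)))"
    using d I by (intro sum_mono mult_left_mono member_le_sum) auto
  also have "\<dots> = (trace_norm I M)\<^sup>2" unfolding tn by (simp add: power2_eq_square sum_distrib_right)
  finally show ?thesis using s0 unfolding tn by (rule power2_le_imp_le)
qed

lemma density_entry_le_1:
  assumes "density_on I M" "i \<in> I" "j \<in> I"
  shows "cmod (M i j) \<le> 1"
proof -
  have I: "finite I" and M: "psd_on I M" and T: "op_trace I M = 1" using assms by (auto simp: density_on_def)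
  obtain U d where Ud: "diagonalizes I M U d" and d: "\<And>k. k \<in> I \<Longrightarrow> 0 \<le> d k"
    and tr: "tr I M = (\<Sum>k\<in>I. d k)"
    using entropy_diagonalization[OF I M] by blast
  have U: "unitary_on I U" using Ud by (simp add: diagonalizes_def)
  have le: "cmod (U l k) \<le> 1" if "l \<in> I" "k \<in> I" for l k
  proof -
    have "(cmod (U l k))\<^sup>2 \<le> norm2_on I (col U k)"
      unfolding norm2_on_def by (rule member_le_sum) (use that I in auto)
    then show ?thesis
      using orthonormal_on_norm2[OF unitary_on_orthonormal[OF U] that(2)] by (simp add: abs_square_le_1)
  qed
  have "M i j = (\<Sum>k\<in>I. U i k * of_real (d k) * cnj (U j k))"
    using Ud assms by (simp add: diagonalizes_def conj_diag_def)
  then have "cmod (M i j) \<le> (\<Sum>k\<in>I. cmod (U i k * of_real (d k) * cnj (U j k)))"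
    using norm_sum by metis
  also have "\<dots> \<le> (\<Sum>k\<in>I. d k)"
  proof (rule sum_mono)
    fix k assume k: "k \<in> I"
    have "cmod (U i k) * d k * cmod (U j k) \<le> 1 * d k * 1"
      using le k d assms by (intro mult_mono) auto
    then show "cmod (U i k * of_real (d k) * cnj (U j k)) \<le> d k" using d[OF k] by (simp add: norm_mult)
  qed
  finally show ?thesis using tr T by simp
qed

section \<open>Continuity of squashed entanglement\<close>

lemma quad_form_delta: "quad_form UNIV delta v = norm2_on (UNIV :: 'n::finite set) v"
proof -
  have "mat_vec UNIV delta v = v"
    by (simp add: mat_vec_def if_distrib[of "\<lambda>x. x * _"] cong: if_cong)
  then show ?thesis by (simp add: quad_form_def inner_on_self)
qed

lemma density_onD:
  assumes "density_on I M"
  shows "finite I" "psd_on I M" "op_trace I M = 1"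
  using assms by (auto simp: density_on_def)

section \<open>Turning an extension of one state into an extension of another\<close>

text \<open>Any extension of the maximally mixed state would do.\<close>

definition mixed_ext :: "('x::finite \<times> nat) opm"
  where "mixed_ext = (\<lambda>i j. if i = j \<and> snd i = 0 then of_real (1 / real CARD('x)) else 0)"

lemma psd_mixed_ext:
  assumes "finite I"
  shows "psd_on I (mixed_ext :: ('x::finite \<times> nat) opm)"
  unfolding psd_on_iff
proof (intro conjI allI)
  let ?M = "mixed_ext :: ('x \<times> nat) opm"
  show "hermitian_on I ?M" by (auto simp: hermitian_on_def mixed_ext_def)
  fix v
  have "(\<Sum>j\<in>I. cnj (v i) * ?M i j * v j)
      = of_real (if snd i = 0 then (cmod (v i))\<^sup>2 / real CARD('x) else 0)" if "i \<in> I" for i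
  proof -
    have "(\<Sum>j\<in>I. cnj (v i) * ?M i j * v j)
        = (\<Sum>j\<in>I. if j = i then (if snd i = 0 then cnj (v i) * of_real (1 / real CARD('x)) * v i else 0) else 0)"
      by (intro sum.cong refl) (auto simp: mixed_ext_def)
    then show ?thesis
      using assms that by (simp add: complex_norm_square mult.commute del: of_real_power)
  qed
  then have "quad_form I ?M v = Re (\<Sum>i\<in>I. of_real (if snd i = 0 then (cmod (v i))\<^sup>2 / real CARD('x) else 0))"
    unfolding quad_form_sum by simp
  then show "0 \<le> quad_form I ?M v" by (simp add: sum_nonneg)
qed

lemma red_AB_mixed_ext:
  assumes "0 < n"
  shows "red_AB n mixed_ext = (\<lambda>x y :: 'a::finite \<times> 'b::finite. of_real (1 / real CARD('a \<times> 'b)) * delta x y)"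
  using assms by (auto simp: red_AB_def mixed_ext_def fun_eq_iff)

text \<open>The extension \<open>\<tau>\<close> is first mixed with a full-rank state, so that the reduced state \<open>\<omega>\<close> becomes
  invertible; conjugation by \<open>\<sigma>\<^sup>1\<^sup>/\<^sup>2 \<omega>\<^sup>-\<^sup>1\<^sup>/\<^sup>2\<close> then turns it into an extension of \<open>\<sigma>\<close>.\<close>

lemma extension_transport:
  fixes \<rho> \<sigma> :: "('a::finite \<times> 'b::finite) opm"
  assumes \<rho>: "density_on UNIV \<rho>" and \<sigma>: "density_on UNIV \<sigma>"
    and \<tau>: "density_on (sys n) \<tau>" "red_AB n \<tau> = \<rho>"
    and t: "0 < t" "t \<le> 1 / 3" and e: "\<epsilon> = t\<^sup>2 / (3 * real CARD('a \<times> 'b) ^ 3)"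
    and close: "\<And>x y. cmod (\<sigma> x y - \<rho> x y) \<le> \<epsilon>"
  shows "\<exists>\<tau>'. density_on (sys n) \<tau>' \<and> red_AB n \<tau>' = \<sigma> \<and> cond_mutual_info n \<tau>'
    \<le> cond_mutual_info n \<tau> + (2 * cmi_err (real CARD('b)) (2 * t + t\<^sup>2) + 2 * cmi_err (real CARD('b)) \<epsilon>)"
proof -
  let ?D = "real CARD('a \<times> 'b)" and ?U = "UNIV :: ('a \<times> 'b) set" and ?I = "sys n :: (('a \<times> 'b) \<times> nat) set"
  have D: "1 \<le> ?D" using zero_less_card_finite[where 'a="'a \<times> 'b"] by linarith
  have e0: "0 < \<epsilon>" using t D by (simp add: e)
  have "t\<^sup>2 \<le> 1" using t by (simp add: power_le_one)
  moreover have "1 \<le> 3 * ?D ^ 3" using one_le_power[OF D, of 3] by linarith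
  ultimately have e1: "\<epsilon> \<le> 1" unfolding e by (simp add: divide_le_eq)
  \<comment> \<open>Trace 1 excludes an empty \<open>E\<close>, so the index 0 on which
    \<open>mixed_ext\<close> is supported exists.\<close>
  have n: "0 < n" using density_onD(3)[OF \<tau>(1)] by (cases "n = 0") (auto simp: op_trace_def)
  \<comment> \<open>\<open>P\<close> is the common positive part: \<open>\<tau>\<close> is
    \<open>P + E1\<close> and the mixture \<open>T\<close> is \<open>P + E2\<close>, both increments
    having trace \<open>\<epsilon>\<close>.\<close>
  define P where "P = (\<lambda>i j. of_real (1 - \<epsilon>) * \<tau> i j)"
  define E1 where "E1 = (\<lambda>i j. of_real \<epsilon> * \<tau> i j)"
  define E2 where "E2 = (\<lambda>i j. of_real \<epsilon> * (mixed_ext :: (('a \<times> 'b) \<times> nat) opm) i j)"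
  define T where "T = (\<lambda>i j. P i j + E2 i j)"
  have \<tau>_eq: "\<tau> = (\<lambda>i j. P i j + E1 i j)" by (auto simp: P_def E1_def fun_eq_iff algebra_simps)
  have pP: "psd_on ?I P" and pE1: "psd_on ?I E1" and pE2: "psd_on ?I E2"
    unfolding P_def E1_def E2_def using density_onD[OF \<tau>(1)] e0 e1
    by (intro psd_on_scale psd_mixed_ext; simp)+
  then have pT: "psd_on ?I T" unfolding T_def by (intro psd_on_add)
  have trk: "op_trace ?I mixed_ext = 1"
    unfolding op_trace_red_AB red_AB_mixed_ext[OF n] by (simp add: op_trace_def)
  have trP: "op_trace ?I P = of_real (1 - \<epsilon>)" and trE1: "op_trace ?I E1 = of_real \<epsilon>"
    and trE2: "op_trace ?I E2 = of_real \<epsilon>"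
    unfolding P_def E1_def E2_def op_trace_scale using density_onD(3)[OF \<tau>(1)] trk by simp_all
  have trT: "tr ?I T = 1" unfolding T_def op_trace_add trP trE2 by simp
  have "\<bar>cond_mutual_info n T - cond_mutual_info n P\<bar> \<le> cmi_err (real CARD('b)) \<epsilon>"
    unfolding T_def using pP pE2 trP trE2 e0 e1 by (intro cond_mutual_info_perturb) auto
  moreover have "\<bar>cond_mutual_info n \<tau> - cond_mutual_info n P\<bar> \<le> cmi_err (real CARD('b)) \<epsilon>"
    by (subst \<tau>_eq, rule cond_mutual_info_perturb) (use pP pE1 trP trE1 e0 e1 in auto)
  ultimately have step1: "\<bar>cond_mutual_info n T - cond_mutual_info n \<tau>\<bar> \<le> 2 * cmi_err (real CARD('b)) \<epsilon>"
    by linarith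
  define \<omega> where "\<omega> = (\<lambda>x y. of_real (1 - \<epsilon>) * \<rho> x y + of_real (\<epsilon> / ?D) * delta x y)"
  have "red_AB n E2 = (\<lambda>x y. of_real \<epsilon> * red_AB n mixed_ext x y)"
    by (simp add: E2_def red_AB_def sum_distrib_left)
  moreover have "red_AB n P = (\<lambda>x y. of_real (1 - \<epsilon>) * red_AB n \<tau> x y)"
    by (simp add: P_def red_AB_def sum_distrib_left)
  moreover have "red_AB n T = (\<lambda>x y. red_AB n P x y + red_AB n E2 x y)"
    by (simp add: T_def red_AB_def sum.distrib)
  ultimately have redT: "red_AB n T = \<omega>"
    unfolding \<omega>_def red_AB_mixed_ext[OF n] \<tau>(2) by (simp add: fun_eq_iff)
  have pd: "psd_on ?U delta"
    unfolding psd_on_iff quad_form_delta by (auto simp: hermitian_on_def norm2_on_nonneg)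
  have p\<omega>: "psd_on ?U \<omega>"
    unfolding \<omega>_def using density_onD(2)[OF \<rho>] pd e0 e1 by (intro psd_on_add psd_on_scale) auto
  have "\<epsilon> / ?D * norm2_on ?U v \<le> quad_form ?U \<omega> v" for v
    using density_onD(2)[OF \<rho>] e1
    unfolding \<omega>_def quad_form_add quad_form_scale quad_form_delta psd_on_iff by simp
  moreover have "0 < \<epsilon> / ?D" using e0 D by simp
  ultimately have "\<exists>c>0. \<forall>v. c * norm2_on ?U v \<le> quad_form ?U \<omega> v" by blast
  then obtain R Q where R: "psd_on ?U R" "op_mult ?U R R = \<omega>" and Q: "op_mult ?U Q R = delta"
    using psd_square_root[OF p\<omega>] by metis
  obtain B where B: "psd_on ?U B" "op_mult ?U B B = \<sigma>"
    using psd_square_root[OF density_onD(2)[OF \<sigma>]] by metis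
  \<comment> \<open>\<open>Q\<close> is the inverse root of \<open>\<omega>\<close>, so
    \<open>K R = B\<close> and \<open>L R = B - R\<close>: conjugation by \<open>K\<close> sends
    \<open>\<omega>\<close> to \<open>\<sigma>\<close>, and conjugation by \<open>L\<close> leaves
    the squared distance of the roots as trace.\<close>
  define K where "K = op_mult ?U B Q"
  define L where "L = (\<lambda>x y. K x y - delta x y)"
  have KL: "(\<lambda>x y. delta x y + L x y) = K" by (simp add: L_def fun_eq_iff)
  have KR: "op_mult ?U K R = B"
    unfolding K_def op_mult_assoc Q by (rule op_mult_delta_right)
  have "op_mult ?U L R = (\<lambda>x y. op_mult ?U K R x y - op_mult ?U delta R x y)"
    unfolding L_def op_mult_def by (simp add: left_diff_distrib sum_subtractf)
  then have LR: "op_mult ?U L R = (\<lambda>x y. B x y - R x y)"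
    unfolding KR op_mult_delta_left .
  have hR: "hermitian_on ?U R" and hB: "hermitian_on ?U B" using R B by (auto simp: psd_on_iff)
  have "sandwich ?U K \<omega> = (\<lambda>i j. \<Sum>m\<in>?U. B i m * cnj (B j m))"
    unfolding R(2)[symmetric] sandwich_square[OF hR] KR ..
  also have "\<dots> = op_mult ?U B B"
  proof (intro ext)
    fix i j
    have "cnj (B j m) = B m j" for m using hB unfolding hermitian_on_def by (metis UNIV_I)
    then show "(\<Sum>m\<in>?U. B i m * cnj (B j m)) = op_mult ?U B B i j" by (simp add: op_mult_def)
  qed
  finally have K\<omega>: "sandwich ?U K \<omega> = \<sigma>" using B(2) by simp
  have "op_trace ?U (sandwich ?U L \<omega>) = of_real (\<Sum>i\<in>?U. \<Sum>m\<in>?U. (cmod (B i m - R i m))\<^sup>2)"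
    unfolding R(2)[symmetric] sandwich_square[OF hR] LR
    by (simp add: op_trace_def complex_norm_square del: of_real_power)
  then have "tr ?U (sandwich ?U L \<omega>) = (\<Sum>i\<in>?U. \<Sum>m\<in>?U. (cmod (B i m - R i m))\<^sup>2)" by simp
  also have "\<dots> \<le> ?D * (\<Sum>x\<in>?U. \<Sum>y\<in>?U. cmod (\<sigma> x y - \<omega> x y))"
    using square_root_continuity[OF B(1) R(1)] unfolding B R .
  \<comment> \<open>Each entry moves by at most \<open>\<epsilon>\<close> from
    \<open>\<sigma>\<close> to \<open>\<rho>\<close>, \<open>\<epsilon>\<close> for the removed part
    of \<open>\<rho>\<close> and \<open>\<epsilon>\<close> for the added identity. With
    \<open>?D * ?D\<close> entries and the factor \<open>?D\<close> in front, this is the origin of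
    the denominator \<open>3 * ?D ^ 3\<close> in \<open>\<epsilon>\<close>.\<close>
  also have "\<dots> \<le> ?D * (\<Sum>x\<in>?U. \<Sum>y\<in>?U. 3 * \<epsilon>)"
  proof (intro mult_left_mono sum_mono)
    fix x y
    have "\<sigma> x y - \<omega> x y = (\<sigma> x y - \<rho> x y) + (of_real \<epsilon> * \<rho> x y - of_real (\<epsilon> / ?D) * delta x y)"
      by (simp add: \<omega>_def algebra_simps)
    then have "cmod (\<sigma> x y - \<omega> x y) \<le> cmod (\<sigma> x y - \<rho> x y) + (cmod (of_real \<epsilon> * \<rho> x y) + cmod (of_real (\<epsilon> / ?D) * delta x y))"
      by (metis norm_triangle_ineq norm_triangle_ineq4 add_left_mono order_trans)
    also have "cmod (of_real \<epsilon> * \<rho> x y) \<le> \<epsilon>"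
      using e0 density_entry_le_1[OF \<rho>] by (simp add: norm_mult mult_left_le)
    also have "cmod (of_real (\<epsilon> / ?D) * delta x y) \<le> \<epsilon>"
      using e0 D by (simp add: norm_mult norm_divide divide_le_eq mult_le_cancel_left1)
    finally show "cmod (\<sigma> x y - \<omega> x y) \<le> 3 * \<epsilon>" using close[of x y] by simp
  qed simp
  also have "\<dots> = t\<^sup>2" using D by (simp add: e power3_eq_cube)
  finally have trL: "tr ?U (sandwich ?U L (red_AB n T)) \<le> t\<^sup>2" unfolding redT .
  define \<tau>' where "\<tau>' = sandwich ?I (lift_op K) T"
  have red': "red_AB n \<tau>' = \<sigma>" unfolding \<tau>'_def red_AB_sandwich redT K\<omega> ..
  have "\<bar>cond_mutual_info n \<tau>' - cond_mutual_info n T\<bar> \<le> 2 * cmi_err (real CARD('b)) (2 * t + t\<^sup>2)"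
    using cond_mutual_info_sandwich[OF pT trT t trL] density_onD(3)[OF \<sigma>]
    unfolding KL redT K\<omega> \<tau>'_def by simp
  then have "cond_mutual_info n \<tau>'
    \<le> cond_mutual_info n \<tau> + (2 * cmi_err (real CARD('b)) (2 * t + t\<^sup>2) + 2 * cmi_err (real CARD('b)) \<epsilon>)"
    using step1 by linarith
  moreover have "density_on ?I \<tau>'"
    unfolding density_on_def op_trace_red_AB red' using density_onD(3)[OF \<sigma>] psd_sandwich[OF pT]
    by (simp add: \<tau>'_def)
  ultimately show ?thesis using red' by blast
qed

section \<open>From extensions to the infimum\<close>

text \<open>With a one-dimensional \<open>E\<close> the infimum is seen to range over a nonempty
  set.\<close>

lemma trivial_extension:
  fixes \<rho> :: "complex^('a::finite \<times> 'b::finite)^('a \<times> 'b)"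
  assumes "\<rho> \<in> density_operators"
  shows "extension \<rho> 1 (\<lambda>(x, e) (y, f). entries \<rho> x y)"
proof -
  let ?\<sigma> = "\<lambda>(x, e :: nat) (y, f :: nat). entries \<rho> x y"
  have d: "density_on UNIV (entries \<rho>)" using assms by (simp add: density_operators_def)
  have S: "(\<Sum>k\<in>UNIV \<times> {..<1}. f k) = (\<Sum>x\<in>UNIV. f (x, 0))" for f :: "('a \<times> 'b) \<times> nat \<Rightarrow> complex"
    using sum.cartesian_product[of "\<lambda>x e. f (x, e)" "{..<1}" UNIV] by (simp add: lessThan_Suc case_prod_unfold)
  have "quad_form (sys 1) ?\<sigma> v = quad_form UNIV (entries \<rho>) (\<lambda>x. v (x, 0))" for v
    unfolding quad_form_sum S by simp
  moreover have "entries \<rho> x y = cnj (entries \<rho> y x)" for x y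
    using density_onD(2)[OF d] unfolding psd_on_def hermitian_on_def by blast
  then have "hermitian_on (sys 1) ?\<sigma>" unfolding hermitian_on_def by fast
  ultimately have "psd_on (sys 1) ?\<sigma>" using density_onD(2)[OF d] unfolding psd_on_iff by simp
  moreover have r: "red_AB 1 ?\<sigma> = entries \<rho>" by (auto simp: red_AB_def fun_eq_iff)
  moreover have "op_trace (sys 1) ?\<sigma> = 1" unfolding op_trace_red_AB r by (rule density_onD(3)[OF d])
  ultimately show ?thesis by (simp add: extension_def density_on_def)
qed

text \<open>The real \<open>Inf\<close> is meaningful only for nonempty sets bounded below; the
  lower bound is the trace bound on I(A;B|E) at trace 1. The loss \<open>2 * c\<close> in the
  hypothesis matches the factor 1/2 in the definition.\<close>

lemma squashed_entanglement_le:
  fixes \<rho> \<sigma> :: "complex^('a::finite \<times> 'b::finite)^('a \<times> 'b)"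
  assumes \<rho>: "\<rho> \<in> density_operators"
    and step: "\<And>n \<tau>. extension \<rho> n \<tau> \<Longrightarrow>
      \<exists>\<tau>'. extension \<sigma> n \<tau>' \<and> cond_mutual_info n \<tau>' \<le> cond_mutual_info n \<tau> + 2 * c"
  shows "squashed_entanglement \<sigma> \<le> squashed_entanglement \<rho> + c"
proof -
  let ?A = "\<lambda>\<rho>. {cond_mutual_info n \<tau> / 2 | n \<tau>. extension \<rho> n \<tau>}"
  have bdd: "bdd_below (?A \<sigma>)"
  proof (rule bdd_belowI)
    fix a assume "a \<in> ?A \<sigma>"
    then obtain n \<tau> where a: "a = cond_mutual_info n \<tau> / 2" and "extension \<sigma> n \<tau>" by blast
    then show "- (real CARD('b) / ln 2) \<le> a"
      using cond_mutual_info_bound[of n \<tau>] density_onD[of "sys n" \<tau>] by (simp add: extension_def)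
  qed
  have "squashed_entanglement \<sigma> - c \<le> a" if "a \<in> ?A \<rho>" for a
  proof -
    obtain n \<tau> where a: "a = cond_mutual_info n \<tau> / 2" and "extension \<rho> n \<tau>" using \<open>a \<in> ?A \<rho>\<close> by blast
    with step obtain \<tau>' where \<tau>': "extension \<sigma> n \<tau>'" "cond_mutual_info n \<tau>' \<le> cond_mutual_info n \<tau> + 2 * c"
      by blast
    have "squashed_entanglement \<sigma> \<le> cond_mutual_info n \<tau>' / 2"
      unfolding squashed_entanglement_def using \<tau>'(1) by (intro cInf_lower bdd) blast
    then show ?thesis using \<tau>'(2) by (simp add: a)
  qed
  moreover have "?A \<rho> \<noteq> {}" using trivial_extension[OF \<rho>] by blast
  ultimately have "squashed_entanglement \<sigma> - c \<le> squashed_entanglement \<rho>"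
    unfolding squashed_entanglement_def[of \<rho>] by (intro cInf_greatest)
  then show ?thesis by simp
qed

text \<open>One-sided, but \<open>\<delta>\<close> precedes both states and the closeness is
  symmetric, so exchanging the states gives the other inequality.\<close>

lemma squashed_entanglement_uniformly_continuous:
  assumes "0 < \<eta>"
  shows "\<exists>\<delta>>0. \<forall>\<rho>\<in>density_operators. \<forall>\<sigma>\<in>density_operators.
    (\<forall>x y. cmod (entries \<sigma> x y - entries \<rho> x y) \<le> \<delta>) \<longrightarrow>
    squashed_entanglement (\<sigma> :: complex^('a::finite \<times> 'b::finite)^('a \<times> 'b)) \<le> squashed_entanglement \<rho> + \<eta>"
proof -
  let ?D = "real CARD('a \<times> 'b)" and ?err = "cmi_err (real CARD('b))"
  have D: "1 \<le> ?D" using zero_less_card_finite[where 'a="'a \<times> 'b"] by linarith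
  have "\<forall>\<^sub>F m in at_right 0. ?err m < \<eta> / 2"
    using assms by (intro order_tendstoD(2)[OF cmi_err_tendsto]) simp
  then obtain b where b: "0 < b" "\<And>m. 0 < m \<Longrightarrow> m < b \<Longrightarrow> ?err m < \<eta> / 2"
    unfolding eventually_at_right_field by blast
  \<comment> \<open>Since \<open>t\<^sup>2 \<le> t\<close>, \<open>t \<le> b / 4\<close> puts both
    arguments of the error, \<open>2 * t + t\<^sup>2 \<le> 3 * t\<close> and
    \<open>\<delta> \<le> t\<^sup>2\<close>, strictly below \<open>b\<close>.\<close>
  define t where "t = min (1 / 3) (b / 4)"
  have t: "0 < t" "t \<le> 1 / 3" "4 * t \<le> b" using b(1) by (auto simp: t_def)
  have tt: "t\<^sup>2 \<le> t" using t by (simp add: power2_eq_square mult_left_le)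
  define \<delta> where "\<delta> = t\<^sup>2 / (3 * ?D ^ 3)"
  have "t\<^sup>2 * 1 \<le> t\<^sup>2 * (3 * ?D ^ 3)"
    using one_le_power[OF D, of 3] by (intro mult_left_mono) auto
  then have "\<delta> \<le> t\<^sup>2" using D by (simp add: \<delta>_def divide_le_eq)
  then have d: "0 < \<delta>" "\<delta> < b" using t D tt by (auto simp: \<delta>_def)
  have "0 < 2 * t + t\<^sup>2" using t(1) by (simp add: add_pos_nonneg)
  moreover have "2 * t + t\<^sup>2 < b" using t tt by linarith
  ultimately have e: "?err \<delta> < \<eta> / 2" "?err (2 * t + t\<^sup>2) < \<eta> / 2"
    using b(2) d by blast+
  show ?thesis
  proof (intro exI conjI ballI impI)
    fix \<rho> \<sigma> :: "complex^('a \<times> 'b)^('a \<times> 'b)"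
    assume \<rho>: "\<rho> \<in> density_operators" and \<sigma>: "\<sigma> \<in> density_operators"
      and close: "\<forall>x y. cmod (entries \<sigma> x y - entries \<rho> x y) \<le> \<delta>"
    show "squashed_entanglement \<sigma> \<le> squashed_entanglement \<rho> + \<eta>"
    proof (rule squashed_entanglement_le[OF \<rho>])
      fix n \<tau> assume "extension \<rho> n \<tau>"
      then have \<tau>: "density_on (sys n) \<tau>" "red_AB n \<tau> = entries \<rho>" by (auto simp: extension_def)
      have "density_on UNIV (entries \<rho>)" "density_on UNIV (entries \<sigma>)"
        using \<rho> \<sigma> by (simp_all add: density_operators_def)
      from extension_transport[OF this \<tau> t(1,2) \<delta>_def] close
      obtain \<tau>' where "density_on (sys n) \<tau>'" "red_AB n \<tau>' = entries \<sigma>"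
        "cond_mutual_info n \<tau>' \<le> cond_mutual_info n \<tau> + (2 * ?err (2 * t + t\<^sup>2) + 2 * ?err \<delta>)"
        by blast
      moreover from this(3) have "cond_mutual_info n \<tau>' \<le> cond_mutual_info n \<tau> + 2 * \<eta>"
        using e by linarith
      ultimately show "\<exists>\<tau>'. extension \<sigma> n \<tau>' \<and> cond_mutual_info n \<tau>' \<le> cond_mutual_info n \<tau> + 2 * \<eta>"
        by (auto simp: extension_def)
    qed
  qed (rule d(1))
qed

lemma squashed_entanglement_continuous:
  fixes X :: "(complex^('a::finite \<times> 'b::finite)^('a \<times> 'b)) set"
  assumes X: "X \<subseteq> density_operators"
  shows "trace_norm_continuous_on X squashed_entanglement"
  unfolding trace_norm_continuous_on_def
proof (intro ballI allI impI)
  fix \<rho> and \<epsilon> :: real assume \<rho>: "\<rho> \<in> X" and "0 < \<epsilon>"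
  then obtain \<delta> where \<delta>: "0 < \<delta>" and *: "\<And>\<rho> \<sigma> :: complex^('a \<times> 'b)^('a \<times> 'b).
      \<rho> \<in> density_operators \<Longrightarrow> \<sigma> \<in> density_operators \<Longrightarrow>
      (\<And>x y. cmod (entries \<sigma> x y - entries \<rho> x y) \<le> \<delta>) \<Longrightarrow>
      squashed_entanglement \<sigma> \<le> squashed_entanglement \<rho> + \<epsilon> / 2"
    using squashed_entanglement_uniformly_continuous[of "\<epsilon> / 2", where 'a='a and 'b='b] by (metis half_gt_zero)
  show "\<exists>\<delta>>0. \<forall>\<sigma>\<in>X. trace_norm UNIV (entries (\<sigma> - \<rho>)) < \<delta>
      \<longrightarrow> \<bar>squashed_entanglement \<sigma> - squashed_entanglement \<rho>\<bar> < \<epsilon>"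
  proof (intro exI conjI ballI impI)
    fix \<sigma> assume \<sigma>: "\<sigma> \<in> X" and tn: "trace_norm UNIV (entries (\<sigma> - \<rho>)) < \<delta>"
    have c: "cmod (entries \<sigma> x y - entries \<rho> x y) \<le> \<delta>" for x y
      using entry_le_trace_norm[OF finite_class.finite_UNIV UNIV_I UNIV_I, of "entries (\<sigma> - \<rho>)" x y] tn
      by (simp add: entries_def)
    then have c': "cmod (entries \<rho> x y - entries \<sigma> x y) \<le> \<delta>" for x y
      by (simp add: norm_minus_commute)
    have "squashed_entanglement \<sigma> \<le> squashed_entanglement \<rho> + \<epsilon> / 2"
      "squashed_entanglement \<rho> \<le> squashed_entanglement \<sigma> + \<epsilon> / 2"
      using X \<rho> \<sigma> by (auto intro!: * c c')
    then show "\<bar>squashed_entanglement \<sigma> - squashed_entanglement \<rho>\<bar> < \<epsilon>" using \<open>0 < \<epsilon>\<close> by linarith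
  qed (rule \<delta>)
qed

section \<open>The interior of the set of states\<close>

lemma full_rank_iff_trivial_kernel:
  fixes A :: "'a::field^'n^'n"
  shows "rank A = CARD('n) \<longleftrightarrow> (\<forall>x. A *v x = 0 \<longrightarrow> x = 0)"
  by (simp add: matrix_left_invertible_ker[symmetric] matrix_left_invertible_span_rows_gen
      row_rank_def_gen vec.dim_eq_full[symmetric] card_cart_basis vec.dimension_def)

lemma mat_vec_entries: "mat_vec UNIV (entries A) (\<lambda>i. x $ i) = (\<lambda>i. (A *v x) $ i)"
  by (simp add: mat_vec_def entries_def matrix_vector_mult_def)

lemma trace_entries: "op_trace UNIV (entries A) = trace A"
  by (simp add: op_trace_def entries_def trace_def)

lemma density_operators_alt:
  "\<rho> \<in> density_operators \<longleftrightarrow> \<rho> \<in> trace_one_hermitian \<and> (\<forall>v. 0 \<le> quad_form UNIV (entries \<rho>) v)"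
  by (auto simp: density_operators_def trace_one_hermitian_def density_on_def psd_on_iff trace_entries)

lemma full_rank_density_bound:
  fixes \<rho> :: "complex^'n::finite^'n"
  assumes "\<rho> \<in> density_operators" "rank \<rho> = CARD('n)"
  shows "\<exists>c>0. \<forall>v. c * norm2_on UNIV v \<le> quad_form UNIV (entries \<rho>) v"
proof -
  have "psd_on UNIV (entries \<rho>)" using assms(1) by (simp add: density_operators_def density_on_def)
  then obtain U d where Ud: "diagonalizes UNIV (entries \<rho>) U d" and d: "\<And>k. 0 \<le> d k"
    using entropy_diagonalization[OF finite_class.finite_UNIV] by (metis UNIV_I)
  have U: "unitary_on UNIV U" using Ud by (simp add: diagonalizes_def)
  have pos: "0 < d k" for k
  proof (rule ccontr)
    assume "\<not> 0 < d k"
    then have "d k = 0" using d[of k] by simp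
    then have "mat_vec UNIV (entries \<rho>) (\<lambda>i. U i k) = (\<lambda>i. 0)"
      using diagonalizes_eigenvector[OF finite_class.finite_UNIV Ud, of k] by auto
    then have "\<rho> *v (\<chi> i. U i k) = 0"
      using mat_vec_entries[of \<rho> "\<chi> i. U i k"] by (simp add: vec_eq_iff fun_eq_iff)
    then have "(\<chi> i. U i k) = 0" using assms(2) full_rank_iff_trivial_kernel by blast
    then have "norm2_on UNIV (\<lambda>i. U i k) = 0" by (simp add: vec_eq_iff norm2_on_def)
    then show False using orthonormal_on_norm2[OF unitary_on_orthonormal[OF U], of k] by simp
  qed
  define c where "c = Min (range d)"
  have c: "0 < c" "\<And>k. c \<le> d k" using pos by (auto simp: c_def)
  have "c * norm2_on UNIV v \<le> quad_form UNIV (entries \<rho>) v" for v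
    unfolding diagonalizes_quad_form[OF Ud] unitary_on_parseval[OF finite_class.finite_UNIV U, symmetric] sum_distrib_left
    using c(2) by (intro sum_mono mult_right_mono) auto
  then show ?thesis using c(1) by blast
qed

lemma quad_form_entries_diff:
  "quad_form UNIV (entries A) v = quad_form UNIV (entries B) v + quad_form UNIV (entries (A - B)) v"
  unfolding quad_form_add[symmetric] by (simp add: entries_def)

lemma interior_density_operators:
  "(top_of_set trace_one_hermitian) interior_of density_operators
    = {\<rho> :: complex^'n::finite^'n. \<rho> \<in> density_operators \<and> rank \<rho> = CARD('n)}"
proof (intro equalityI subsetI CollectI conjI)
  let ?D = "real CARD('n)"
  fix \<rho> :: "complex^'n^'n" assume "\<rho> \<in> (top_of_set trace_one_hermitian) interior_of density_operators"
  then obtain T where T: "openin (top_of_set trace_one_hermitian) T" "\<rho> \<in> T" "T \<subseteq> density_operators"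
    by (auto simp: interior_of_def)
  then show \<rho>: "\<rho> \<in> density_operators" by blast
  from T obtain e where e: "0 < e" "\<And>M. M \<in> trace_one_hermitian \<Longrightarrow> dist M \<rho> < e \<Longrightarrow> M \<in> density_operators"
    unfolding openin_euclidean_subtopology_iff by (meson subsetD)
  \<comment> \<open>Moving from \<open>\<rho>\<close> a little further away from the maximally mixed
    state must still give a state. Positivity of the result bounds \<open>\<rho>\<close> below by a
    positive multiple of the identity, so its kernel is trivial.\<close>
  define N where "N = \<rho> - mat (of_real (1 / ?D))"
  \<comment> \<open>The summand 1 covers the case \<open>N = 0\<close>, where \<open>\<rho>\<close>
    is maximally mixed.\<close>
  define s where "s = e / (2 * (norm N + 1))"
  have s: "0 < s" using e by (simp add: s_def add_nonneg_pos)
  define M where "M = \<rho> + s *\<^sub>R N"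
  have "s * norm N < s * (2 * (norm N + 1))" using s by (intro mult_strict_left_mono) (auto simp: add_nonneg_pos)
  also have "\<dots> = e"
  proof -
    have "norm N + 1 \<noteq> 0" using norm_ge_zero[of N] by linarith
    then show ?thesis unfolding s_def by simp
  qed
  finally have dist: "dist M \<rho> < e" using s by (simp add: M_def dist_norm)
  have M: "entries M = (\<lambda>i j. of_real (1 + s) * entries \<rho> i j + of_real (- (s / ?D)) * delta i j)"
    by (auto simp: M_def N_def entries_def mat_def fun_eq_iff scaleR_conv_of_real[where 'a=complex] algebra_simps)
  have h: "hermitian_on UNIV (entries \<rho>)" and tr1: "trace \<rho> = 1"
    using \<rho> by (auto simp: density_operators_alt trace_one_hermitian_def)
  have "hermitian_on UNIV (delta :: 'n opm)" by (auto simp: hermitian_on_def)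
  then have "hermitian_on UNIV (entries M)"
    unfolding M using h by (intro hermitian_on_add hermitian_on_scale)
  moreover have "trace M = 1"
    unfolding trace_entries[symmetric] M op_trace_add op_trace_scale
    unfolding trace_entries tr1 by (simp add: op_trace_def)
  ultimately have "M \<in> density_operators" using e(2)[OF _ dist] by (simp add: trace_one_hermitian_def)
  then have "0 \<le> (1 + s) * quad_form UNIV (entries \<rho>) v + - (s / ?D) * norm2_on UNIV v" for v
    unfolding density_operators_alt M quad_form_add quad_form_scale quad_form_delta by blast
  note pos = this
  have "x = 0" if "\<rho> *v x = 0" for x
  proof -
    have "quad_form UNIV (entries \<rho>) (\<lambda>i. x $ i) = 0"
      unfolding quad_form_def mat_vec_entries that by (simp add: inner_on_def)
    then have "s / ?D * norm2_on UNIV (\<lambda>i. x $ i) \<le> 0" using pos[of "\<lambda>i. x $ i"] by simp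
    then have "norm2_on UNIV (\<lambda>i. x $ i) \<le> 0"
      using s zero_less_card_finite[where 'a='n] by (simp add: mult_le_0_iff divide_le_0_iff)
    then have "norm2_on UNIV (\<lambda>i. x $ i) = 0" using norm2_on_nonneg order.antisym by blast
    then show "x = 0" by (simp add: norm2_on_eq_0 vec_eq_iff)
  qed
  then show "rank \<rho> = CARD('n)" unfolding full_rank_iff_trivial_kernel by blast
next
  let ?D = "real CARD('n)"
  fix \<rho> :: "complex^'n^'n" assume "\<rho> \<in> {\<rho>. \<rho> \<in> density_operators \<and> rank \<rho> = CARD('n)}"
  then have \<rho>: "\<rho> \<in> density_operators" and rank: "rank \<rho> = CARD('n)" by auto
  obtain c where c: "0 < c" "\<And>v. c * norm2_on UNIV v \<le> quad_form UNIV (entries \<rho>) v"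
    using full_rank_density_bound[OF \<rho> rank] by blast
  \<comment> \<open>A matrix within \<open>r\<close> of \<open>\<rho>\<close> differs by at most
    \<open>r\<close> in each of \<open>?D * ?D\<close> entries, so its quadratic form changes by at
    most \<open>c\<close> times the squared norm, which the lower bound on \<open>\<rho>\<close>
    absorbs.\<close>
  define r where "r = c / (?D * ?D)"
  have D: "0 < ?D" by simp
  let ?T = "trace_one_hermitian \<inter> ball \<rho> r"
  have "?T \<subseteq> density_operators"
  proof
    fix M assume M: "M \<in> ?T"
    have "0 \<le> quad_form UNIV (entries M) v" for v
    proof -
      have "cmod (entries (M - \<rho>) i j) \<le> r" for i j
        using Finite_Cartesian_Product.norm_nth_le[of "(M - \<rho>) $ i" j] Finite_Cartesian_Product.norm_nth_le[of "M - \<rho>" i] M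
        by (simp add: entries_def dist_norm norm_minus_commute)
      then have "(\<Sum>i\<in>UNIV. \<Sum>j\<in>UNIV. cmod (entries (M - \<rho>) i j)) \<le> (\<Sum>i\<in>(UNIV::'n set). \<Sum>j\<in>(UNIV::'n set). r)"
        by (intro sum_mono)
      also have "\<dots> = c" using D by (simp add: r_def)
      finally have "norm2_on UNIV v * (\<Sum>i\<in>UNIV. \<Sum>j\<in>UNIV. cmod (entries (M - \<rho>) i j)) \<le> norm2_on UNIV v * c"
        using norm2_on_nonneg by (rule mult_left_mono)
      then have "\<bar>quad_form UNIV (entries (M - \<rho>)) v\<bar> \<le> c * norm2_on UNIV v"
        using quad_form_le_entries[OF finite_class.finite_UNIV, of "entries (M - \<rho>)" v] by (simp add: mult.commute)
      then show ?thesis using c(2)[of v] quad_form_entries_diff[of M v \<rho>] by linarith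
    qed
    then show "M \<in> density_operators" using M by (simp add: density_operators_alt)
  qed
  moreover have "openin (top_of_set trace_one_hermitian) ?T" by (intro openin_open_Int open_ball)
  moreover have "\<rho> \<in> ?T" using \<rho> c(1) D by (simp add: density_operators_alt r_def)
  ultimately show "\<rho> \<in> (top_of_set trace_one_hermitian) interior_of density_operators"
    unfolding interior_of_def by blast
qed

text \<open>Every set in question lies inside the states, so the uniform estimate restricts to it.
  The first conjunct ties the topological interior to the faithful states.\<close>

theorem proposition16:
  fixes S :: "(complex^('a::finite \<times> 'b::finite)^('a \<times> 'b)) set"
  assumes "S = density_operators"
  shows "(top_of_set trace_one_hermitian) interior_of S = {\<rho> \<in> S. rank \<rho> = CARD('a \<times> 'b)}
    \<and> trace_norm_continuous_on ((top_of_set trace_one_hermitian) interior_of S) squashed_entanglement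
    \<and> (\<forall>F. F face_of S \<longrightarrow> trace_norm_continuous_on (rel_interior F) squashed_entanglement)
    \<and> trace_norm_continuous_on {\<rho> \<in> S. rank \<rho> = 2} squashed_entanglement"
proof (intro conjI allI impI)
  show "(top_of_set trace_one_hermitian) interior_of S = {\<rho> \<in> S. rank \<rho> = CARD('a \<times> 'b)}"
    unfolding assms by (rule interior_density_operators)
  show "trace_norm_continuous_on ((top_of_set trace_one_hermitian) interior_of S) squashed_entanglement"
    unfolding assms by (rule squashed_entanglement_continuous[OF interior_of_subset])
  show "trace_norm_continuous_on (rel_interior F) squashed_entanglement" if "F face_of S" for F
    using that face_of_imp_subset rel_interior_subset unfolding assms
    by (intro squashed_entanglement_continuous) blast
  show "trace_norm_continuous_on {\<rho> \<in> S. rank \<rho> = 2} squashed_entanglement"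
    unfolding assms by (rule squashed_entanglement_continuous) blast
qed

end
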